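(* Let $\theta\in(0,1]$, $\alpha\in(0,1)$, $t>0$, and let $E\subset\mathbb{R}^n$ be non-empty and bounded. If $\underline{\dim}_\theta^{t}E<t$, then $$\underline{\dim}_\theta^{t}E\ \ge\ \underline{\dim}_\theta E-\max\left\{0,\ \overline{\dim}_A^{\alpha}E-t,\ (\dim_AE-t)(1-\alpha)\right\}.$$ If $\overline{\dim}_\theta^{t}E<t$, then $$\overline{\dim}_\theta^{t}E\ \ge\ \overline{\dim}_\theta E-\max\left\{0,\ \overline{\dim}_A^{\alpha}E-t,\ (\dim_AE-t)(1-\alpha)\right\}.$$
   Context: $|U|$ denotes the diameter of a set $U$, and $B(x,R)$ the open ball with centre $x$ and radius $R$. Intermediate dimensions. For a non-empty bounded set $F\subset\mathbb{R}^n$ and $\theta\in(0,1]$, the lower $\theta$-intermediate dimension $\underline{\dim}_\theta F$ is the infimum of all $s\ge 0$ such that for all $\epsilon>0$ and all $\delta_0>0$ there exist $0<\delta\le\delta_0$ and a cover $\{U_i\}_{i\in I}$ of $F$ with $\delta^{1/\theta}\le|U_i|\le\delta$ for all $i$ and $\sum_{i}|U_i|^s\le\epsilon$. The upper $\theta$-intermediate dimension $\overline{\dim}_\theta F$ is the infimum of all $s\ge 0$ such that for all $\epsilon>0$ there exists $\delta_0>0$ such that for all $0<\delta\le\delta_0$ there is a cover $\{U_i\}_{i\in I}$ of $F$ with $\delta^{1/\theta}\le|U_i|\le\delta$ for all $i$ and $\sum_i|U_i|^s\le\epsilon$. Intermediate dimension profiles. For $\theta\in(0,1]$, $t>0$,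 $0\le s\le t$ and $0<r<1$ define, for $x\in\mathbb{R}^n$, $\phi_{r,\theta}^{s,t}(x)=1$ if $0\le|x|<r$; $\phi_{r,\theta}^{s,t}(x)=(r/|x|)^s$ if $r\le|x|\le r^\theta$; $\phi_{r,\theta}^{s,t}(x)=r^{\theta(t-s)+s}/|x|^t$ if $r^\theta\le|x|$. Let $$C_{r,\theta}^{s,t}(E)=\left(\inf_{\mu\in\mathcal{M}(E)}\iint\phi_{r,\theta}^{s,t}(x-y)\,d\mu(x)\,d\mu(y)\right)^{-1},$$ where $\mathcal{M}(E)$ is the set of Borel probability measures supported on $E$. For real $t>0$, the lower profile $\underline{\dim}_\theta^tE$ is the unique $s\in[0,t]$ such that $\liminf_{r\to0}\frac{\log C_{r,\theta}^{s,t}(E)}{-\log r}=s$, and the upper profile $\overline{\dim}_\theta^tE$ is the unique $s\in[0,t]$ such that $\limsup_{r\to0}\frac{\log C_{r,\theta}^{s,t}(E)}{-\log r}=s$ (existence and uniqueness are known). Assouad-type dimensions. $N_r(F)$ is the minimum number of sets of diameter $r$ that can cover $F$. The Assouad dimension $\dim_AE$ is the infimum of all $s$ for which there is $C>0$ such that $N_r(B(x,R)\cap E)\le C(R/r)^s$ for all $0<r<R$ and all $x\in E$. For $\alpha\in(0,1)$, the upper Assouad spectrum $\overline{\dim}_A^{\alpha}E$ is the infimum of all $s$ for which there is $C>0$ such that $N_r(B(x,R)\cap E)\le C(R/r)^s$ for all $0<r\le R^{1/\alpha}<R<1$ and all $x\in E$. *)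

theory Defs
  imports "HOL-Probability.Probability"
begin

section \<open>Intermediate dimensions\<close>

text \<open>
  \<open>diameter\<close> is only meaningful on bounded sets, hence the explicit boundedness conditions below.
  The sum of a cover is taken in \<^typ>\<open>ennreal\<close>, so that no summability or cardinality
  restriction on the cover is needed: a divergent sum is \<open>\<infinity>\<close>.  Covers are sets (rather
  than indexed families) of sets; repetitions in a family only increase the sum.
\<close>

definition admissible_cover ::
  "real \<Rightarrow> real \<Rightarrow> (real ^ 'n) set \<Rightarrow> (real ^ 'n) set set \<Rightarrow> bool" where
  "admissible_cover \<theta> \<delta> F \<U> \<longleftrightarrow>
     F \<subseteq> \<Union>\<U> \<and>
     (\<forall>U\<in>\<U>. bounded U \<and> \<delta> powr (1 / \<theta>) \<le> diameter U \<and> diameter U \<le> \<delta>)"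

definition cover_sum :: "real \<Rightarrow> (real ^ 'n) set set \<Rightarrow> ennreal" where
  "cover_sum s \<U> = (\<Sum>\<^sub>\<infinity>U\<in>\<U>. ennreal (diameter U powr s))"

text \<open>
  For non-empty bounded \<open>F\<close> the sets of exponents below are non-empty and bounded below, so the
  real infimum is the genuine one.
\<close>

definition lower_intermediate_dim :: "real \<Rightarrow> (real ^ 'n) set \<Rightarrow> real" where
  "lower_intermediate_dim \<theta> F =
     Inf {s. 0 \<le> s \<and>
       (\<forall>\<epsilon>>0. \<forall>\<delta>\<^sub>0>0. \<exists>\<delta>. 0 < \<delta> \<and> \<delta> \<le> \<delta>\<^sub>0 \<and>
          (\<exists>\<U>. admissible_cover \<theta> \<delta> F \<U> \<and> cover_sum s \<U> \<le> ennreal \<epsilon>))}"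

definition upper_intermediate_dim :: "real \<Rightarrow> (real ^ 'n) set \<Rightarrow> real" where
  "upper_intermediate_dim \<theta> F =
     Inf {s. 0 \<le> s \<and>
       (\<forall>\<epsilon>>0. \<exists>\<delta>\<^sub>0>0. \<forall>\<delta>. 0 < \<delta> \<and> \<delta> \<le> \<delta>\<^sub>0 \<longrightarrow>
          (\<exists>\<U>. admissible_cover \<theta> \<delta> F \<U> \<and> cover_sum s \<U> \<le> ennreal \<epsilon>))}"


section \<open>Intermediate dimension profiles\<close>

definition profile_kernel ::
  "real \<Rightarrow> real \<Rightarrow> real \<Rightarrow> real \<Rightarrow> real ^ 'n \<Rightarrow> real" where
  "profile_kernel r \<theta> s t x =
     (if norm x < r then 1
      else if norm x \<le> r powr \<theta> then (r / norm x) powr s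
      else r powr (\<theta> * (t - s) + s) / norm x powr t)"

text \<open>
  ``Supported on \<open>E\<close>'' means that the complement of \<open>E\<close> is null; \<open>E\<close> need not be Borel, so this
  says that the complement is contained in a Borel set of measure zero.
\<close>

definition borel_prob_measures_on :: "(real ^ 'n) set \<Rightarrow> (real ^ 'n) measure set" where
  "borel_prob_measures_on E = {\<mu>. prob_space \<mu> \<and> sets \<mu> = sets borel \<and> (AE x in \<mu>. x \<in> E)}"

text \<open>
  The kernel is Borel and takes values in \<open>[0,1]\<close>, so the Bochner integrals exist; for non-empty
  bounded \<open>E\<close> the infimum is positive.
\<close>

definition profile_capacity ::
  "real \<Rightarrow> real \<Rightarrow> real \<Rightarrow> real \<Rightarrow> (real ^ 'n) set \<Rightarrow> real" where
  "profile_capacity r \<theta> s t E =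
     inverse (INF \<mu>\<in>borel_prob_measures_on E.
       (LINT y|\<mu>. (LINT x|\<mu>. profile_kernel r \<theta> s t (x - y))))"

definition lower_dim_profile :: "real \<Rightarrow> real \<Rightarrow> (real ^ 'n) set \<Rightarrow> real" where
  "lower_dim_profile \<theta> t E =
     (THE s. 0 \<le> s \<and> s \<le> t \<and>
        Liminf (at_right 0) (\<lambda>r. ereal (ln (profile_capacity r \<theta> s t E) / (- ln r))) = ereal s)"

definition upper_dim_profile :: "real \<Rightarrow> real \<Rightarrow> (real ^ 'n) set \<Rightarrow> real" where
  "upper_dim_profile \<theta> t E =
     (THE s. 0 \<le> s \<and> s \<le> t \<and>
        Limsup (at_right 0) (\<lambda>r. ereal (ln (profile_capacity r \<theta> s t E) / (- ln r))) = ereal s)"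


section \<open>Assouad-type dimensions\<close>

text \<open>
  For bounded \<open>F\<close> and \<open>r > 0\<close> a finite cover exists, so the infimum over \<^typ>\<open>nat\<close> is a minimum.
\<close>

definition covering_number :: "real \<Rightarrow> (real ^ 'n) set \<Rightarrow> nat" where
  "covering_number r F =
     Inf {card \<U> | \<U>. finite \<U> \<and> F \<subseteq> \<Union>\<U> \<and> (\<forall>U\<in>\<U>. bounded U \<and> diameter U = r)}"

definition assouad_dim :: "(real ^ 'n) set \<Rightarrow> real" where
  "assouad_dim E =
     Inf {s. \<exists>C>0. \<forall>r R. 0 < r \<and> r < R \<longrightarrow>
       (\<forall>x\<in>E. real (covering_number r (ball x R \<inter> E)) \<le> C * (R / r) powr s)}"

definition upper_assouad_spectrum :: "real \<Rightarrow> (real ^ 'n) set \<Rightarrow> real" where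
  "upper_assouad_spectrum \<alpha> E =
     Inf {s. \<exists>C>0. \<forall>r R. 0 < r \<and> r \<le> R powr (1 / \<alpha>) \<and> R powr (1 / \<alpha>) < R \<and> R < 1 \<longrightarrow>
       (\<forall>x\<in>E. real (covering_number r (ball x R \<inter> E)) \<le> C * (R / r) powr s)}"

end

theory Submission
  imports Defs "HOL-Real_Asymp.Real_Asymp"
begin

text \<open>
  Fix \<open>s\<close> equal to the profile value, let \<open>M\<close> be the maximum in the statement and let \<open>\<eta> > 0\<close>.
  The claim is that \<open>E\<close> has covers by sets with diameters between \<open>r\<close> and \<open>r powr \<theta>\<close> whose sums with exponent
  \<open>s + M + \<eta>\<close> tend to 0, for small \<open>r\<close> such that the capacity at scale \<open>r\<close> is at most
  \<open>r powr (- s - \<epsilon>)\<close>, where \<open>\<epsilon> = \<theta> * \<eta> / 8\<close>.  For the lower profile such \<open>r\<close> occur arbitrarily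
  close to 0, for the upper profile all sufficiently small \<open>r\<close> qualify.

  Small capacity means that every probability measure on \<open>E\<close> has energy at least \<open>r powr (s + \<epsilon>)\<close>.
  Minimising the energy over weights on a finite \<open>r\<close>-net produces a measure whose potential is that
  large at every net point (\<open>equilibrium_weights\<close>).  A large potential at \<open>x\<close> must come from one of
  boundedly many scales (\<open>potential_concentrates\<close>): up to small powers of \<open>r\<close>, some ball about \<open>x\<close> of
  radius \<open>\<rho>\<close> has mass at least \<open>r powr s / k \<rho>\<close>, where \<open>k\<close> is the radial kernel.  By
  the Vitali covering lemma \<open>E\<close> is covered by fixed multiples of disjoint balls of this kind, so it
  suffices that each of them can be covered at a cost proportional to its mass
  (\<open>cover_of_heavy_ball\<close>).  When \<open>\<rho>\<close> is at most of order \<open>r powr \<theta>\<close> the mass is at least \<open>\<rho> powr s\<close>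
  and the ball itself can be used.  When \<open>\<rho>\<close> is larger the mass is at least
  \<open>(\<rho> / d) powr t * d powr s\<close> with \<open>d = r powr \<theta>\<close>, and the ball has to be cut into sets of diameter
  \<open>d\<close>.  The number of these is at most \<open>(\<rho> / d) powr t * d powr (- M)\<close>, up to constants and small powers
  of \<open>d\<close>; this is exactly what the Assouad dimension and the Assouad spectrum
  provide, the former for \<open>\<rho> < d powr \<alpha>\<close> and the latter for larger \<open>\<rho>\<close> (\<open>local_cover\<close>).

  The profiles are defined as the unique fixed point of the map sending \<open>s\<close> to a limiting capacity
  exponent.  That map is a contraction with constant \<open>1 - \<theta>\<close>, which gives existence and uniqueness
  (\<open>unique_profile_exponent\<close>).
\<close>

section \<open>Nets, covering numbers and Assouad-type exponents\<close>

text \<open>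
  Volume comparison: the balls of radius \<open>r/2\<close> about the points of a separated set are disjoint and all
  lie in \<open>ball x (2 * R)\<close>, because \<open>r < R\<close>.
\<close>
lemma card_separated_le:
  fixes x :: "'a::euclidean_space"
  assumes r: "0 < r" "r < R" and Y: "finite Y" "Y \<subseteq> ball x R"
    and sep: "\<And>y z. y \<in> Y \<Longrightarrow> z \<in> Y \<Longrightarrow> y \<noteq> z \<Longrightarrow> r \<le> dist y z"
  shows "real (card Y) \<le> (4 * R / r) ^ DIM('a)"
proof -
  let ?v = "unit_ball_vol (real DIM('a))"
  have disj: "disjoint_family_on (\<lambda>y. ball y (r/2)) Y"
  proof (unfold disjoint_family_on_def, intro ballI impI, rule ccontr)
    fix y z assume yz: "y \<in> Y" "z \<in> Y" "y \<noteq> z" "ball y (r/2) \<inter> ball z (r/2) \<noteq> {}"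
    then obtain w where "dist y w < r/2" "dist z w < r/2" by auto
    then have "dist y z < r" by (metis dist_commute dist_triangle_half_l)
    with sep yz show False by force
  qed
  have sub: "(\<Union>y\<in>Y. ball y (r/2)) \<subseteq> ball x (2 * R)"
  proof
    fix w assume "w \<in> (\<Union>y\<in>Y. ball y (r/2))"
    then obtain y where "y \<in> Y" "dist y w < r/2" by auto
    moreover have "dist x w \<le> dist x y + dist y w" by (rule dist_triangle)
    ultimately show "w \<in> ball x (2 * R)" using Y(2) r by fastforce
  qed
  have "real (card Y) * (?v * (r/2) ^ DIM('a)) = (\<Sum>y\<in>Y. measure lborel (ball y (r/2)))"
    using r by (simp add: content_ball)
  also have "\<dots> = measure lborel (\<Union>y\<in>Y. ball y (r/2))"
    by (rule measure_finite_Union[symmetric]) (use Y disj in \<open>auto simp: emeasure_ball less_imp_le r\<close>)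
  also have "\<dots> \<le> measure lborel (ball x (2 * R))"
    by (rule measure_mono_fmeasurable[OF sub])
      (use r in \<open>auto simp: open_UN emeasure_ball intro!: borel_open fmeasurableI\<close>)
  also have "\<dots> = ?v * (2 * R) ^ DIM('a)"
    using r by (simp add: content_ball)
  finally have "?v * (real (card Y) * (r/2) ^ DIM('a)) \<le> ?v * (2 * R) ^ DIM('a)"
    by (simp add: ac_simps)
  then have "real (card Y) * (r/2) ^ DIM('a) \<le> (2 * R) ^ DIM('a)"
    by (simp add: mult_le_cancel_left_pos)
  then have "real (card Y) \<le> (2 * R) ^ DIM('a) / (r/2) ^ DIM('a)"
    using r by (simp add: field_simps)
  also have "\<dots> = (4 * R / r) ^ DIM('a)"
    by (simp only: power_divide[symmetric]) simp
  finally show ?thesis .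
qed

text \<open>
  A separated subset of maximal cardinality exists by the volume bound, and maximality makes it a net.
  The polynomial bound on its cardinality is what keeps the Assouad-type dimensions finite.
\<close>
lemma finite_net:
  fixes F :: "'a::euclidean_space set"
  assumes F: "F \<subseteq> ball x R" and r: "0 < r" "r < R"
  obtains Y where "finite Y" "Y \<subseteq> F" "F \<subseteq> (\<Union>y\<in>Y. ball y r)"
    "real (card Y) \<le> (4 * R / r) ^ DIM('a)"
proof -
  define P where "P Y \<longleftrightarrow> finite Y \<and> Y \<subseteq> F \<and> (\<forall>y\<in>Y. \<forall>z\<in>Y. y \<noteq> z \<longrightarrow> r \<le> dist y z)" for Y
  have bd: "real (card Y) \<le> (4 * R / r) ^ DIM('a)" if "P Y" for Y
    by (rule card_separated_le[OF r]) (use that F in \<open>auto simp: P_def\<close>)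
  have "\<exists>Y. P Y \<and> (\<forall>Z. P Z \<longrightarrow> card Z \<le> card Y)"
  proof (rule ex_has_greatest_nat)
    show "P {}" by (simp add: P_def)
    show "\<forall>Y. P Y \<longrightarrow> card Y < Suc (nat \<lfloor>(4 * R / r) ^ DIM('a)\<rfloor>)"
      using bd by (auto simp: less_Suc_eq_le le_nat_floor)
  qed
  then obtain Y where Y: "P Y" and max: "\<And>Z. P Z \<Longrightarrow> card Z \<le> card Y" by auto
  have "F \<subseteq> (\<Union>y\<in>Y. ball y r)"
  proof (rule ccontr)
    assume "\<not> ?thesis"
    then obtain w where w: "w \<in> F" "w \<notin> (\<Union>y\<in>Y. ball y r)" by (meson subsetI)
    then have "P (insert w Y)" using Y by (fastforce simp: P_def dist_commute)
    moreover have "w \<notin> Y" using w r by auto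
    ultimately show False using max[of "insert w Y"] Y by (simp add: P_def)
  qed
  then show thesis using that Y bd unfolding P_def by blast
qed

lemma covering_number_attained:
  fixes F :: "(real ^ 'n) set"
  assumes F: "bounded F" and r: "0 < r"
  obtains \<U> where "finite \<U>" "F \<subseteq> \<Union>\<U>" "\<And>U. U \<in> \<U> \<Longrightarrow> bounded U \<and> diameter U = r"
    "card \<U> = covering_number r F"
proof -
  let ?N = "{card \<U> | \<U>. finite \<U> \<and> F \<subseteq> \<Union>\<U> \<and> (\<forall>U\<in>\<U>. bounded U \<and> diameter U = r)}"
  obtain R0 where R0: "F \<subseteq> ball 0 R0" using bounded_subset_ballD[OF F] by blast
  have "F \<subseteq> ball 0 (max R0 r)" using R0 by auto
  then obtain Y where Y: "finite Y" "F \<subseteq> (\<Union>y\<in>Y. ball y (r/2))"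
    using finite_net[of F 0 "max R0 r" "r/2"] r
    by (metis half_gt_zero_iff less_max_iff_disj field_sum_of_halves less_add_same_cancel1)
  have "card ((\<lambda>y. ball y (r/2)) ` Y) \<in> ?N"
    using Y r by (auto simp del: card_image intro!: exI[of _ "(\<lambda>y. ball y (r/2)) ` Y"])
  then have "?N \<noteq> {}" by blast
  then have "Inf ?N \<in> ?N" by (rule Inf_nat_def1)
  then show thesis using that unfolding covering_number_def by auto
qed

text \<open>
  This is what makes the sets of exponents in the two Assouad-type dimensions non-empty.  On an empty
  set \<open>Inf\<close> is an unspecified real number, and a strict upper bound on it would carry no information.
\<close>
lemma covering_number_ball_le:
  fixes E :: "(real ^ 'n) set"
  assumes r: "0 < r" "r < R"
  shows "real (covering_number r (ball x R \<inter> E)) \<le> 8 ^ CARD('n) * (R / r) powr CARD('n)"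
proof -
  obtain Y where Y: "finite Y" "ball x R \<inter> E \<subseteq> (\<Union>y\<in>Y. ball y (r/2))"
    "real (card Y) \<le> (4 * R / (r/2)) ^ DIM(real^'n)"
    by (rule finite_net[of "ball x R \<inter> E" x R "r/2"]) (use r in auto)
  have "covering_number r (ball x R \<inter> E) \<le> card ((\<lambda>y. ball y (r/2)) ` Y)"
    unfolding covering_number_def
    by (rule cInf_lower) (use Y r in \<open>auto simp del: card_image intro!: exI[of _ "(\<lambda>y. ball y (r/2)) ` Y"]\<close>)
  also have "\<dots> \<le> card Y" by (rule card_image_le[OF Y(1)])
  finally have "real (covering_number r (ball x R \<inter> E)) \<le> (8 * (R / r)) ^ CARD('n)"
    using Y(3) by simp
  then show ?thesis
    unfolding power_mult_distrib using r by (simp only: powr_realpow divide_pos_pos order.strict_trans)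
qed

lemma assouad_bound_above:
  fixes E :: "(real ^ 'n) set"
  assumes "assouad_dim E < s"
  obtains C where "0 < C" "\<And>r R x. 0 < r \<Longrightarrow> r < R \<Longrightarrow> x \<in> E \<Longrightarrow>
      real (covering_number r (ball x R \<inter> E)) \<le> C * (R / r) powr s"
proof -
  let ?S = "{s. \<exists>C>0. \<forall>r R. 0 < r \<and> r < R \<longrightarrow>
       (\<forall>x\<in>E. real (covering_number r (ball x R \<inter> E)) \<le> C * (R / r) powr s)}"
  have "real CARD('n) \<in> ?S"
    using covering_number_ball_le by (force intro!: exI[of _ "8 ^ CARD('n)"])
  then have "?S \<noteq> {}" by blast
  then obtain a where a: "a \<in> ?S" "a < s"
    using cInf_lessD[of ?S s] assms unfolding assouad_dim_def by blast
  then obtain C where C: "0 < C" "\<And>r R x. 0 < r \<Longrightarrow> r < R \<Longrightarrow> x \<in> E \<Longrightarrow>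
      real (covering_number r (ball x R \<inter> E)) \<le> C * (R / r) powr a" by blast
  have "C * (R / r) powr a \<le> C * (R / r) powr s" if "0 < r" "r < R" for r R
    using C(1) a(2) that by (intro mult_left_mono powr_mono) auto
  with C show thesis by (meson order_trans that)
qed

lemma spectrum_bound_above:
  fixes E :: "(real ^ 'n) set"
  assumes "upper_assouad_spectrum \<alpha> E < s" and \<alpha>: "0 < \<alpha>" "\<alpha> < 1"
  obtains C where "0 < C" "\<And>r R x. 0 < r \<Longrightarrow> r \<le> R powr (1 / \<alpha>) \<Longrightarrow> 0 < R \<Longrightarrow> R < 1 \<Longrightarrow> x \<in> E \<Longrightarrow>
      real (covering_number r (ball x R \<inter> E)) \<le> C * (R / r) powr s"
proof -
  let ?S = "{s. \<exists>C>0. \<forall>r R. 0 < r \<and> r \<le> R powr (1 / \<alpha>) \<and> R powr (1 / \<alpha>) < R \<and> R < 1 \<longrightarrow>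
       (\<forall>x\<in>E. real (covering_number r (ball x R \<inter> E)) \<le> C * (R / r) powr s)}"
  have "real CARD('n) \<in> ?S"
    using covering_number_ball_le by (force intro!: exI[of _ "8 ^ CARD('n)"])
  then have "?S \<noteq> {}" by blast
  then obtain a where a: "a \<in> ?S" "a < s"
    using cInf_lessD[of ?S s] assms unfolding upper_assouad_spectrum_def by blast
  have lt: "R powr (1 / \<alpha>) < R" if "0 < R" "R < 1" for R
    using powr_less_mono'[of R 1 "1/\<alpha>"] that \<alpha> by (simp add: field_simps)
  obtain C where C: "0 < C" "\<And>r R x. 0 < r \<Longrightarrow> r \<le> R powr (1 / \<alpha>) \<Longrightarrow> 0 < R \<Longrightarrow> R < 1 \<Longrightarrow> x \<in> E \<Longrightarrow>
      real (covering_number r (ball x R \<inter> E)) \<le> C * (R / r) powr a"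
    using a(1) lt by blast
  have "C * (R / r) powr a \<le> C * (R / r) powr s" if "0 < r" "r \<le> R powr (1 / \<alpha>)" "0 < R" "R < 1" for r R
    using C(1) a(2) that lt[of R] by (intro mult_left_mono powr_mono) auto
  with C show thesis by (meson order_trans that)
qed

section \<open>Equilibrium weights on finite sets\<close>

text \<open>
  The finite form of the equilibrium measure of potential theory.  Minimise the energy over the simplex
  of probability weights, which is compact in the product topology.  Moving mass \<open>h\<close> from the minimiser
  \<open>p\<close> to the point \<open>i\<close> changes the energy by \<open>2 * h * (V i - Q)\<close> to first order, where \<open>V i\<close> is the
  potential at \<open>i\<close> and \<open>Q\<close> the minimal energy.  Hence \<open>Q \<le> V i\<close> at every point, not only on the
  support of \<open>p\<close>, which is essential because every point has to be covered later.
\<close>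
lemma equilibrium_weights:
  fixes K :: "'a \<Rightarrow> 'a \<Rightarrow> real"
  assumes Y: "finite Y" "Y \<noteq> {}" and sym: "\<And>i j. K i j = K j i"
  obtains p where "\<And>i. 0 \<le> p i" "\<And>i. i \<notin> Y \<Longrightarrow> p i = 0" "sum p Y = 1"
    "\<And>i. i \<in> Y \<Longrightarrow> (\<Sum>i\<in>Y. \<Sum>j\<in>Y. p i * p j * K i j) \<le> (\<Sum>j\<in>Y. p j * K i j)"
proof -
  define \<Delta> where "\<Delta> = (PiE UNIV (\<lambda>i. if i \<in> Y then {0..1::real} else {0})) \<inter> {p. sum p Y = 1}"
  define Q where "Q p = (\<Sum>i\<in>Y. \<Sum>j\<in>Y. p i * p j * K i j)" for p :: "'a \<Rightarrow> real"
  have mem: "p \<in> \<Delta> \<longleftrightarrow> (\<forall>i. 0 \<le> p i) \<and> (\<forall>i. i \<notin> Y \<longrightarrow> p i = 0) \<and> sum p Y = 1" for p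
  proof -
    have "p i \<le> 1" if "\<forall>i. 0 \<le> p i" "sum p Y = 1" "i \<in> Y" for i
      using that Y(1) by (metis member_le_sum Diff_iff)
    then show ?thesis unfolding \<Delta>_def by (auto simp: PiE_iff Pi_iff split: if_splits) (metis order_refl)+
  qed
  have "compactin (product_topology (\<lambda>_. euclidean) UNIV) (PiE UNIV (\<lambda>i. if i \<in> Y then {0..1::real} else {0}))"
    by (subst compactin_PiE) auto
  then have "compact (PiE UNIV (\<lambda>i. if i \<in> Y then {0..1::real} else {0}))"
    by (simp add: euclidean_product_topology)
  moreover have "closed {p :: 'a \<Rightarrow> real. sum p Y = 1}"
    by (intro closed_Collect_eq continuous_intros continuous_on_product_coordinates)
  ultimately have "compact \<Delta>" unfolding \<Delta>_def by (rule compact_Int_closed)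
  moreover have "\<Delta> \<noteq> {}"
  proof -
    obtain y where "y \<in> Y" using Y(2) by blast
    then have "(\<lambda>i. if i = y then 1 else 0) \<in> \<Delta>" using Y by (auto simp: mem)
    then show ?thesis by blast
  qed
  moreover have "continuous_on \<Delta> Q"
    unfolding Q_def
    by (intro continuous_intros continuous_on_subset[OF continuous_on_product_coordinates]) auto
  ultimately obtain p where p: "p \<in> \<Delta>" and min: "\<And>q. q \<in> \<Delta> \<Longrightarrow> Q p \<le> Q q"
    using continuous_attains_inf[of \<Delta> Q] by blast
  have "Q p \<le> (\<Sum>j\<in>Y. p j * K i j)" if i: "i \<in> Y" for i
  proof (rule ccontr)
    define V where "V = (\<Sum>j\<in>Y. p j * K i j)"
    define c where "c = Q p - V"
    assume "\<not> ?thesis"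
    then have c: "c > 0" by (simp add: c_def V_def)
    \<comment> \<open>The first variation, divided by \<open>h\<close>; letting \<open>h\<close> tend to 0 contradicts \<open>c > 0\<close>.\<close>
    have ineq: "2 * (1 - h) * c \<le> h * (K i i - Q p)" if h: "0 < h" "h \<le> 1" for h
    proof -
      define q where "q = (\<lambda>j. (1 - h) * p j + h * (if j = i then 1 else 0))"
      have "q \<in> \<Delta>" using p i h Y by (auto simp: mem q_def sum.distrib sum_distrib_left[symmetric])
      then have "Q p \<le> Q q" by (rule min)
      also have "Q q = (\<Sum>a\<in>Y. \<Sum>b\<in>Y. (1-h)^2 * (p a * p b * K a b) + (1-h)*h * (p a * (if b = i then K a b else 0))
          + (1-h)*h * (if a = i then p b * K a b else 0) + h^2 * (if a = i then if b = i then K a b else 0 else 0))"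
        unfolding Q_def q_def by (intro sum.cong refl) (auto simp: algebra_simps power2_eq_square)
      also have "\<dots> = (1-h)^2 * Q p + (1-h)*h * (\<Sum>a\<in>Y. p a * K a i) + (1-h)*h * V + h^2 * K i i"
      proof -
        have "(\<Sum>a\<in>Y. \<Sum>b\<in>Y. if a = i then p b * K a b else 0) = V"
          using i Y by (subst sum.swap) (simp add: V_def)
        moreover have "(\<Sum>a\<in>Y. \<Sum>b\<in>Y. if a = i then if b = i then K a b else 0 else 0) = K i i"
          using i Y by (subst sum.swap) simp
        ultimately show ?thesis
          using i Y by (simp add: sum.distrib sum_distrib_left[symmetric] Q_def)
      qed
      also have "(\<Sum>a\<in>Y. p a * K a i) = V" unfolding V_def by (intro sum.cong refl) (metis sym)
      finally have "h * (2 * (1 - h) * c) \<le> h * (h * (K i i - Q p))"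
        by (simp add: c_def algebra_simps power2_eq_square)
      then show ?thesis using h by (simp add: mult_le_cancel_left_pos)
    qed
    have "((\<lambda>h. 2 * (1 - h) * c) \<longlongrightarrow> 2 * (1 - 0) * c) (at_right 0)" by (intro tendsto_intros)
    moreover have "((\<lambda>h. h * (K i i - Q p)) \<longlongrightarrow> 0 * (K i i - Q p)) (at_right 0)" by (intro tendsto_intros)
    moreover have "eventually (\<lambda>h. 2 * (1 - h) * c \<le> h * (K i i - Q p)) (at_right 0)"
      using eventually_at_right_less[of 0] eventually_at_right[of 0 1] ineq
      by (auto simp: eventually_at_right[of 0 1] intro!: exI[of _ 1])
    ultimately have "2 * (1 - 0) * c \<le> 0 * (K i i - Q p)"
      by (intro tendsto_le[of "at_right (0::real)"]) auto
    with c show False by simp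
  qed
  then show thesis using p that by (auto simp: mem Q_def)
qed

text \<open>
  Transporting along the identity replaces the discrete sigma-algebra of a probability mass function by
  the Borel one.
\<close>
definition discrete_measure :: "((real ^ 'n) \<Rightarrow> real) \<Rightarrow> (real ^ 'n) measure" where
  "discrete_measure p = distr (measure_pmf (embed_pmf p)) borel (\<lambda>x. x)"

lemma discrete_measure:
  fixes p :: "real ^ 'n \<Rightarrow> real"
  assumes Y: "finite Y" and p: "\<And>i. 0 \<le> p i" "\<And>i. i \<notin> Y \<Longrightarrow> p i = 0" "sum p Y = 1"
  shows "Y \<subseteq> E \<Longrightarrow> discrete_measure p \<in> borel_prob_measures_on E"
    and "f \<in> borel_measurable borel \<Longrightarrow> (LINT x|discrete_measure p. f x) = (\<Sum>y\<in>Y. p y * f y)"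
proof -
  have "(\<integral>\<^sup>+x. ennreal (p x) \<partial>count_space UNIV) = (\<Sum>y\<in>Y. ennreal (p y))"
    using Y p by (intro nn_integral_count_space'[of Y]) auto
  also have "\<dots> = 1" using p by (simp add: sum_ennreal)
  finally have pmf: "pmf (embed_pmf p) x = p x" for x by (intro pmf_embed_pmf p)
  have set: "set_pmf (embed_pmf p) \<subseteq> Y" using p(2) by (force simp: set_pmf_eq pmf)
  show "discrete_measure p \<in> borel_prob_measures_on E" if "Y \<subseteq> E"
  proof -
    have "AE x in discrete_measure p. x \<in> Y"
      unfolding discrete_measure_def using set Y
      by (subst AE_distr_iff) (auto simp: AE_measure_pmf_iff finite_imp_closed borel_closed)
    then have "AE x in discrete_measure p. x \<in> E" by eventually_elim (use that in auto)
    then show ?thesis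
      unfolding borel_prob_measures_on_def discrete_measure_def
      by (auto intro!: prob_space.prob_space_distr measure_pmf.prob_space_axioms)
  qed
  show "(LINT x|discrete_measure p. f x) = (\<Sum>y\<in>Y. p y * f y)" if "f \<in> borel_measurable borel"
  proof -
    have "(LINT x|discrete_measure p. f x) = (LINT x|measure_pmf (embed_pmf p). f x)"
      unfolding discrete_measure_def using that by (subst integral_distr) auto
    also have "\<dots> = (\<Sum>y\<in>Y. f y * pmf (embed_pmf p) y)"
      by (rule integral_measure_pmf_real) (use Y set in auto)
    finally show ?thesis by (simp add: pmf mult.commute)
  qed
qed

section \<open>The radial kernel\<close>

definition radial_kernel :: "real \<Rightarrow> real \<Rightarrow> real \<Rightarrow> real \<Rightarrow> real \<Rightarrow> real" where
  "radial_kernel r \<theta> s t \<rho> =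
     (if \<rho> < r then 1
      else if \<rho> \<le> r powr \<theta> then (r / \<rho>) powr s
      else r powr (\<theta> * (t - s) + s) / \<rho> powr t)"

lemma profile_kernel_radial: "profile_kernel r \<theta> s t x = radial_kernel r \<theta> s t (norm x)"
  by (simp add: profile_kernel_def radial_kernel_def)

text \<open>
  The outer branch of the kernel is the inner branch times a power of \<open>r powr \<theta> / \<rho>\<close>.  That factor is at
  least 1 below the threshold \<open>r powr \<theta>\<close> and at most 1 above it, so the kernel is the minimum of its
  branches.
\<close>
lemma powr_exchange:
  fixes r \<rho> \<theta> s t :: real
  assumes "0 < r" "0 < \<rho>"
  shows "r powr (\<theta> * (t - s) + s) / \<rho> powr t = (r / \<rho>) powr s * (r powr \<theta> / \<rho>) powr (t - s)"
  using assms by (simp add: powr_divide powr_powr powr_add[symmetric] powr_diff[symmetric] field_simps)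
   
locale profile_params =
  fixes r \<theta> t :: real
  assumes r: "0 < r" "r < 1" and \<theta>: "0 < \<theta>" "\<theta> \<le> 1" and t: "0 < t"
begin

lemma r_le_r_powr: "r \<le> r powr \<theta>"
  using powr_mono'[of \<theta> 1 r] r \<theta> by simp

lemma radial_kernel_le_inner:
  assumes s: "0 \<le> s" "s \<le> t" and \<rho>: "0 < \<rho>"
  shows "radial_kernel r \<theta> s t \<rho> \<le> (r / \<rho>) powr s"
proof -
  have "1 \<le> (r / \<rho>) powr s" if "\<rho> < r"
    using that s \<rho> by (intro ge_one_powr_ge_zero) auto
  moreover have "(r / \<rho>) powr s * (r powr \<theta> / \<rho>) powr (t - s) \<le> (r / \<rho>) powr s * 1" if "r powr \<theta> \<le> \<rho>"
    using that s \<rho> r by (intro mult_left_mono powr_le1) auto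
  ultimately show ?thesis using r \<rho> unfolding radial_kernel_def powr_exchange[OF r(1) \<rho>]
    by auto
qed

lemma radial_kernel_le_outer:
  assumes s: "0 \<le> s" "s \<le> t" and \<rho>: "0 < \<rho>"
  shows "radial_kernel r \<theta> s t \<rho> \<le> r powr (\<theta> * (t - s) + s) / \<rho> powr t"
proof -
  have *: "1 \<le> (r powr \<theta> / \<rho>) powr (t - s)" if "\<rho> \<le> r powr \<theta>"
    using that s \<rho> by (intro ge_one_powr_ge_zero) auto
  have "1 * 1 \<le> (r / \<rho>) powr s * (r powr \<theta> / \<rho>) powr (t - s)" if "\<rho> < r"
    using that s \<rho> * r_le_r_powr by (intro mult_mono ge_one_powr_ge_zero *) auto
  moreover have "(r / \<rho>) powr s * 1 \<le> (r / \<rho>) powr s * (r powr \<theta> / \<rho>) powr (t - s)" if "\<rho> \<le> r powr \<theta>"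
    using * that by (intro mult_left_mono) auto
  ultimately show ?thesis using r \<rho> unfolding radial_kernel_def powr_exchange[OF r(1) \<rho>]
    by auto
qed

lemma radial_kernel_nonneg: "0 \<le> radial_kernel r \<theta> s t \<rho>"
  by (simp add: radial_kernel_def)

lemma radial_kernel_le_1:
  assumes s: "0 \<le> s" "s \<le> t"
  shows "radial_kernel r \<theta> s t \<rho> \<le> 1"
proof (cases "\<rho> < r")
  case False
  then have "radial_kernel r \<theta> s t \<rho> \<le> (r / \<rho>) powr s" using r by (intro radial_kernel_le_inner s) auto
  also have "\<dots> \<le> 1" using False r s by (intro powr_le1) auto
  finally show ?thesis .
qed (simp add: radial_kernel_def)

lemma radial_kernel_antimono_s:
  assumes "0 \<le> s" "s \<le> s'" "s' \<le> t"
  shows "radial_kernel r \<theta> s' t \<rho> \<le> radial_kernel r \<theta> s t \<rho>"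
proof -
  have "(r / \<rho>) powr s' \<le> (r / \<rho>) powr s" if "\<not> \<rho> < r"
    using that assms r by (intro powr_mono') auto
  moreover have "r powr (\<theta> * (t - s') + s') \<le> r powr (\<theta> * (t - s) + s)"
  proof (intro powr_mono')
    have "(1 - \<theta>) * s \<le> (1 - \<theta>) * s'" using assms \<theta> by (intro mult_left_mono) auto
    then show "\<theta> * (t - s) + s \<le> \<theta> * (t - s') + s'" by (simp add: algebra_simps)
  qed (use r in auto)
  ultimately show ?thesis unfolding radial_kernel_def by (auto intro!: divide_right_mono)
qed

text \<open>
  Raising \<open>s\<close> multiplies the kernel by \<open>(r / \<rho>) powr (s' - s)\<close> in the inner range, where \<open>r / \<rho>\<close> is at
  least \<open>r powr (1 - \<theta>)\<close>, and by exactly \<open>r powr ((1 - \<theta>) * (s' - s))\<close> in the outer range.  The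
  factor \<open>1 - \<theta>\<close> is the contraction constant behind the uniqueness of the profile exponent.
\<close>
lemma radial_kernel_lipschitz_s:
  assumes "0 \<le> s" "s \<le> s'" "s' \<le> t"
  shows "r powr ((1 - \<theta>) * (s' - s)) * radial_kernel r \<theta> s t \<rho> \<le> radial_kernel r \<theta> s' t \<rho>"
proof -
  have "r powr ((1 - \<theta>) * (s' - s)) \<le> 1" using r assms \<theta> by (intro powr_le1) auto
  moreover have "r powr ((1 - \<theta>) * (s' - s)) * (r / \<rho>) powr s \<le> (r / \<rho>) powr s'"
    if "\<not> \<rho> < r" "\<rho> \<le> r powr \<theta>"
  proof -
    have "r powr (1 - \<theta>) \<le> r / \<rho>"
      using that r by (simp add: powr_diff field_simps)
    then have "(r powr (1 - \<theta>)) powr (s' - s) \<le> (r / \<rho>) powr (s' - s)"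
      using assms by (intro powr_mono2) auto
    then have "(r powr (1 - \<theta>)) powr (s' - s) * (r / \<rho>) powr s \<le> (r / \<rho>) powr (s' - s) * (r / \<rho>) powr s"
      by (intro mult_right_mono) auto
    then show ?thesis by (simp add: powr_powr powr_add[symmetric])
  qed
  moreover have "r powr ((1 - \<theta>) * (s' - s)) * (r powr (\<theta> * (t - s) + s) / \<rho> powr t)
      = r powr (\<theta> * (t - s') + s') / \<rho> powr t"
    by (simp add: powr_add[symmetric] algebra_simps)
  ultimately show ?thesis unfolding radial_kernel_def by auto
qed

lemma radial_kernel_antimono:
  assumes s: "0 \<le> s" "s \<le> t" and \<rho>: "\<rho> \<le> \<rho>'"
  shows "radial_kernel r \<theta> s t \<rho>' \<le> radial_kernel r \<theta> s t \<rho>"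
proof -
  consider "\<rho> < r" | "r \<le> \<rho>" "\<rho> \<le> r powr \<theta>" | "r \<le> \<rho>" "r powr \<theta> < \<rho>" by linarith
  then show ?thesis
  proof cases
    case 1
    then show ?thesis using radial_kernel_le_1[OF s] by (simp add: radial_kernel_def)
  next
    case 2
    then have "radial_kernel r \<theta> s t \<rho>' \<le> (r / \<rho>') powr s" using r \<rho> by (intro radial_kernel_le_inner s) auto
    also have "\<dots> \<le> (r / \<rho>) powr s" using 2 r \<rho> s by (intro powr_mono2 divide_left_mono) auto
    finally show ?thesis using 2 by (simp add: radial_kernel_def)
  next
    case 3
    then have "radial_kernel r \<theta> s t \<rho>' \<le> r powr (\<theta> * (t - s) + s) / \<rho>' powr t"
      using r \<rho> by (intro radial_kernel_le_outer s) auto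
    also have "\<dots> \<le> r powr (\<theta> * (t - s) + s) / \<rho> powr t"
      using 3 r \<rho> s by (intro divide_left_mono powr_mono2) auto
    finally show ?thesis using 3 by (simp add: radial_kernel_def)
  qed
qed

text \<open>
  The kernel decays no faster than \<open>\<rho> powr (- t)\<close>, so replacing a distance by a comparable larger scale
  costs a controlled factor.
\<close>
lemma radial_kernel_doubling:
  assumes s: "0 \<le> s" "s \<le> t" and c: "1 \<le> c" and \<rho>: "r \<le> \<rho>"
  shows "radial_kernel r \<theta> s t \<rho> \<le> c powr t * radial_kernel r \<theta> s t (c * \<rho>)"
proof -
  have \<rho>0: "0 < \<rho>" using \<rho> r by linarith
  have ge: "r \<le> c * \<rho>" using c \<rho> r mult_mono[of 1 c r \<rho>] by simp
  show ?thesis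
  proof (cases "c * \<rho> \<le> r powr \<theta>")
    case True
    have "radial_kernel r \<theta> s t \<rho> \<le> (r / \<rho>) powr s" by (rule radial_kernel_le_inner[OF s \<rho>0])
    also have "\<dots> = c powr s * (r / (c * \<rho>)) powr s"
      using c r \<rho>0 by (simp add: powr_mult[symmetric])
    also have "\<dots> \<le> c powr t * (r / (c * \<rho>)) powr s"
      using c s by (intro mult_right_mono powr_mono) auto
    finally show ?thesis using True ge by (simp add: radial_kernel_def)
  next
    case False
    have "radial_kernel r \<theta> s t \<rho> \<le> r powr (\<theta> * (t - s) + s) / \<rho> powr t" by (rule radial_kernel_le_outer[OF s \<rho>0])
    also have "\<dots> = c powr t * (r powr (\<theta> * (t - s) + s) / (c * \<rho>) powr t)"
      using c \<rho>0 by (simp add: powr_mult)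
    finally show ?thesis using False ge by (simp add: radial_kernel_def)
  qed
qed

lemma radial_kernel_t_ge:
  assumes "0 < \<rho>" "r \<le> \<rho>" shows "radial_kernel r \<theta> t t \<rho> = (r / \<rho>) powr t"
  using assms r by (auto simp: radial_kernel_def powr_divide)

end

section \<open>Energies and the defining exponent of the profiles\<close>

lemma profile_kernel_measurable [measurable]: "profile_kernel r \<theta> s t \<in> borel_measurable borel"
  unfolding profile_kernel_def by measurable

lemma double_integral_mono:
  fixes h\<^sub>1 h\<^sub>2 :: "real ^ 'n \<Rightarrow> real"
  assumes \<mu>: "\<mu> \<in> borel_prob_measures_on E"
    and [measurable]: "h\<^sub>1 \<in> borel_measurable borel" "h\<^sub>2 \<in> borel_measurable borel"
    and bd: "\<And>z. \<bar>h\<^sub>1 z\<bar> \<le> B" "\<And>z. \<bar>h\<^sub>2 z\<bar> \<le> B"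
    and le: "\<And>x y. x \<in> E \<Longrightarrow> y \<in> E \<Longrightarrow> h\<^sub>1 (x - y) \<le> h\<^sub>2 (x - y)"
  shows "(LINT y|\<mu>. LINT x|\<mu>. h\<^sub>1 (x - y)) \<le> (LINT y|\<mu>. LINT x|\<mu>. h\<^sub>2 (x - y))"
proof -
  interpret prob_space \<mu> using \<mu> by (simp add: borel_prob_measures_on_def)
  have [measurable_cong]: "sets \<mu> = sets borel" and AE: "AE x in \<mu>. x \<in> E"
    using \<mu> by (auto simp: borel_prob_measures_on_def)
  have int: "integrable \<mu> (\<lambda>x. h (x - y))" and int2: "integrable \<mu> (\<lambda>y. LINT x|\<mu>. h (x - y))"
    if [measurable]: "h \<in> borel_measurable borel" and bd: "\<And>z. \<bar>h z\<bar> \<le> B" for h and y :: "real ^ 'n"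
  proof -
    show int: "integrable \<mu> (\<lambda>x. h (x - y))" for y
      by (rule integrable_const_bound[of _ B]) (auto simp: bd)
    have "\<bar>LINT x|\<mu>. h (x - y)\<bar> \<le> B" for y
    proof -
      have "\<bar>LINT x|\<mu>. h (x - y)\<bar> \<le> (LINT x|\<mu>. \<bar>h (x - y)\<bar>)" by (rule integral_abs_bound)
      also have "\<dots> \<le> (LINT x|\<mu>. B)" by (rule integral_mono) (auto simp: bd int)
      finally show ?thesis by (simp add: prob_space)
    qed
    then show "integrable \<mu> (\<lambda>y. LINT x|\<mu>. h (x - y))"
      by (intro integrable_const_bound[of _ B]) auto
  qed
  show ?thesis
  proof (rule integral_mono_AE)
    show "AE y in \<mu>. (LINT x|\<mu>. h\<^sub>1 (x - y)) \<le> (LINT x|\<mu>. h\<^sub>2 (x - y))"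
      using AE
    proof eventually_elim
      case (elim y)
      show ?case
      proof (rule integral_mono_AE)
        show "AE x in \<mu>. h\<^sub>1 (x - y) \<le> h\<^sub>2 (x - y)" using AE by eventually_elim (use le elim in auto)
      qed (use int bd in auto)
    qed
  qed (use int2 bd in auto)
qed

definition energy :: "real \<Rightarrow> real \<Rightarrow> real \<Rightarrow> real \<Rightarrow> (real ^ 'n) measure \<Rightarrow> real" where
  "energy r \<theta> s t \<mu> = (LINT y|\<mu>. LINT x|\<mu>. profile_kernel r \<theta> s t (x - y))"

definition min_energy :: "real \<Rightarrow> real \<Rightarrow> real \<Rightarrow> real \<Rightarrow> (real ^ 'n) set \<Rightarrow> real" where
  "min_energy r \<theta> s t E = (INF \<mu>\<in>borel_prob_measures_on E. energy r \<theta> s t \<mu>)"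

lemma profile_capacity_min_energy: "profile_capacity r \<theta> s t E = inverse (min_energy r \<theta> s t E)"
  by (simp add: profile_capacity_def min_energy_def energy_def)

lemma energy_nonneg: "0 \<le> energy r \<theta> s t \<mu>"
  unfolding energy_def profile_kernel_radial radial_kernel_def
  by (intro Bochner_Integration.integral_nonneg) auto

lemma borel_prob_measures_on_nonempty:
  assumes "E \<noteq> {}" shows "borel_prob_measures_on E \<noteq> {}"
proof -
  obtain a where "a \<in> E" using assms by blast
  then have "discrete_measure (\<lambda>x. if x = a then 1 else 0) \<in> borel_prob_measures_on E"
    by (intro discrete_measure(1)[of "{a}"]) auto
  then show ?thesis by blast
qed

lemma min_energy_le: "\<mu> \<in> borel_prob_measures_on E \<Longrightarrow> min_energy r \<theta> s t E \<le> energy r \<theta> s t \<mu>"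
  unfolding min_energy_def
  by (rule cINF_lower) (auto intro!: bdd_belowI[of _ 0] simp: energy_nonneg)

context profile_params
begin

lemma abs_profile_kernel_le_1: "0 \<le> s \<Longrightarrow> s \<le> t \<Longrightarrow> \<bar>profile_kernel r \<theta> s t x\<bar> \<le> 1"
  by (simp add: profile_kernel_radial radial_kernel_nonneg radial_kernel_le_1)

lemma energy_antimono_s:
  assumes \<mu>: "\<mu> \<in> borel_prob_measures_on E" and s: "0 \<le> s" "s \<le> s'" "s' \<le> t"
  shows "energy r \<theta> s' t \<mu> \<le> energy r \<theta> s t \<mu>"
  unfolding energy_def
proof (rule double_integral_mono[OF \<mu>])
  show "profile_kernel r \<theta> s' t (x - y) \<le> profile_kernel r \<theta> s t (x - y)" for x y
    unfolding profile_kernel_radial by (rule radial_kernel_antimono_s[OF s])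
qed (use s in \<open>auto intro: abs_profile_kernel_le_1\<close>)

lemma energy_lipschitz_s:
  assumes \<mu>: "\<mu> \<in> borel_prob_measures_on E" and s: "0 \<le> s" "s \<le> s'" "s' \<le> t"
  shows "r powr ((1 - \<theta>) * (s' - s)) * energy r \<theta> s t \<mu> \<le> energy r \<theta> s' t \<mu>"
proof -
  let ?c = "r powr ((1 - \<theta>) * (s' - s))"
  have c: "?c \<le> 1" using r s \<theta> by (intro powr_le1) auto
  have "(LINT y|\<mu>. LINT x|\<mu>. ?c * profile_kernel r \<theta> s t (x - y)) \<le> energy r \<theta> s' t \<mu>"
    unfolding energy_def
  proof (rule double_integral_mono[OF \<mu>, where B = 1])
    show "?c * profile_kernel r \<theta> s t (x - y) \<le> profile_kernel r \<theta> s' t (x - y)" for x y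
      unfolding profile_kernel_radial by (rule radial_kernel_lipschitz_s[OF s])
    have "?c * radial_kernel r \<theta> s t z \<le> 1 * 1" for z
      using c s by (intro mult_mono radial_kernel_le_1 radial_kernel_nonneg) auto
    then show "\<bar>?c * profile_kernel r \<theta> s t z\<bar> \<le> 1" for z
      by (auto simp: profile_kernel_radial abs_mult radial_kernel_nonneg)
  qed (use s in \<open>auto intro: abs_profile_kernel_le_1\<close>)
  then show ?thesis by (simp add: energy_def)
qed

text \<open>
  Over distances up to \<open>D\<close> and exponents \<open>s \<le> t\<close> the kernel is smallest at distance \<open>D\<close> with \<open>s = t\<close>.
\<close>
lemma energy_bounds:
  assumes \<mu>: "\<mu> \<in> borel_prob_measures_on E" and s: "0 \<le> s" "s \<le> t"
    and D: "r \<le> D" "\<And>x y. x \<in> E \<Longrightarrow> y \<in> E \<Longrightarrow> norm (x - y) \<le> D"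
  shows "energy r \<theta> s t \<mu> \<le> 1" "(r / D) powr t \<le> energy r \<theta> s t \<mu>"
proof -
  interpret prob_space \<mu> using \<mu> by (simp add: borel_prob_measures_on_def)
  have "energy r \<theta> s t \<mu> \<le> (LINT y|\<mu>. LINT x|\<mu>. 1)"
    unfolding energy_def
    by (rule double_integral_mono[OF \<mu>, where B = 1 and h\<^sub>2 = "\<lambda>_. 1"])
      (use s in \<open>auto intro: abs_profile_kernel_le_1 abs_le_D1\<close>)
  then show "energy r \<theta> s t \<mu> \<le> 1" by (simp add: prob_space)
  have D0: "0 < D" using D r by linarith
  have le1: "(r / D) powr t \<le> 1" using D r t by (intro powr_le1) auto
  have "(LINT y|\<mu>. LINT x|\<mu>. (r / D) powr t) \<le> energy r \<theta> t t \<mu>"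
    unfolding energy_def
  proof (rule double_integral_mono[OF \<mu>, where B = 1 and h\<^sub>1 = "\<lambda>_. (r / D) powr t"])
    show "(r / D) powr t \<le> profile_kernel r \<theta> t t (x - y)" if "x \<in> E" "y \<in> E" for x y
      unfolding profile_kernel_radial radial_kernel_t_ge[OF D0 D(1), symmetric]
      using t D that by (intro radial_kernel_antimono) auto
  qed (use t le1 in \<open>auto intro: abs_profile_kernel_le_1\<close>)
  also have "\<dots> \<le> energy r \<theta> s t \<mu>" using energy_antimono_s[OF \<mu>] s by simp
  finally show "(r / D) powr t \<le> energy r \<theta> s t \<mu>" by (simp add: prob_space)
qed

lemma min_energy_bounds:
  assumes E: "E \<noteq> {}" and s: "0 \<le> s" "s \<le> t"
    and D: "r \<le> D" "\<And>x y. x \<in> E \<Longrightarrow> y \<in> E \<Longrightarrow> norm (x - y) \<le> D"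
  shows "min_energy r \<theta> s t E \<le> 1" "(r / D) powr t \<le> min_energy r \<theta> s t E" "0 < min_energy r \<theta> s t E"
proof -
  obtain \<mu> where \<mu>: "\<mu> \<in> borel_prob_measures_on E" using borel_prob_measures_on_nonempty[OF E] by blast
  show "min_energy r \<theta> s t E \<le> 1"
    using min_energy_le[OF \<mu>] energy_bounds(1)[OF \<mu> s D] by (meson order_trans)
  show *: "(r / D) powr t \<le> min_energy r \<theta> s t E"
    unfolding min_energy_def
    by (rule cINF_greatest[OF borel_prob_measures_on_nonempty[OF E]]) (rule energy_bounds(2)[OF _ s D])
  have "0 < (r / D) powr t" using r D by auto
  with * show "0 < min_energy r \<theta> s t E" by linarith
qed

lemma min_energy_antimono_s:
  assumes E: "E \<noteq> {}" and s: "0 \<le> s" "s \<le> s'" "s' \<le> t"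
  shows "min_energy r \<theta> s' t E \<le> min_energy r \<theta> s t E"
  unfolding min_energy_def[of r \<theta> s]
proof (rule cINF_greatest[OF borel_prob_measures_on_nonempty[OF E]])
  fix \<mu> assume \<mu>: "\<mu> \<in> borel_prob_measures_on E"
  show "min_energy r \<theta> s' t E \<le> energy r \<theta> s t \<mu>"
    by (rule order_trans[OF min_energy_le[OF \<mu>] energy_antimono_s[OF \<mu> s]])
qed

lemma min_energy_lipschitz_s:
  assumes E: "E \<noteq> {}" and s: "0 \<le> s" "s \<le> s'" "s' \<le> t"
  shows "r powr ((1 - \<theta>) * (s' - s)) * min_energy r \<theta> s t E \<le> min_energy r \<theta> s' t E"
  unfolding min_energy_def[of r \<theta> s']
proof (rule cINF_greatest[OF borel_prob_measures_on_nonempty[OF E]])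
  fix \<mu> assume \<mu>: "\<mu> \<in> borel_prob_measures_on E"
  have "r powr ((1 - \<theta>) * (s' - s)) * min_energy r \<theta> s t E \<le> r powr ((1 - \<theta>) * (s' - s)) * energy r \<theta> s t \<mu>"
    by (intro mult_left_mono min_energy_le \<mu>) auto
  also have "\<dots> \<le> energy r \<theta> s' t \<mu>" by (rule energy_lipschitz_s[OF \<mu> s])
  finally show "r powr ((1 - \<theta>) * (s' - s)) * min_energy r \<theta> s t E \<le> energy r \<theta> s' t \<mu>" .
qed

end

text \<open>
  The quantity whose lower and upper limits as \<open>r\<close> tends to 0 define the profiles.
\<close>
definition capacity_exponent :: "real \<Rightarrow> real \<Rightarrow> (real ^ 'n) set \<Rightarrow> real \<Rightarrow> real \<Rightarrow> real" where
  "capacity_exponent \<theta> t E s r = ln (profile_capacity r \<theta> s t E) / (- ln r)"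

context profile_params
begin

lemma capacity_exponent_min_energy: "capacity_exponent \<theta> t E s r = ln (min_energy r \<theta> s t E) / ln r"
  by (cases "min_energy r \<theta> s t E = 0")
    (auto simp: capacity_exponent_def profile_capacity_min_energy ln_inverse)

lemma capacity_exponent_nonneg:
  assumes E: "E \<noteq> {}" and s: "0 \<le> s" "s \<le> t"
    and D: "r \<le> D" "\<And>x y. x \<in> E \<Longrightarrow> y \<in> E \<Longrightarrow> norm (x - y) \<le> D"
  shows "0 \<le> capacity_exponent \<theta> t E s r"
  using min_energy_bounds[OF E s D] r
  by (auto simp: capacity_exponent_min_energy intro!: divide_nonpos_neg)

text \<open>
  The correction term vanishes as \<open>r\<close> tends to 0, which bounds the limiting exponent by \<open>t\<close>.
\<close>
lemma capacity_exponent_le: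
  assumes E: "E \<noteq> {}" and s: "0 \<le> s" "s \<le> t"
    and D: "r \<le> D" "\<And>x y. x \<in> E \<Longrightarrow> y \<in> E \<Longrightarrow> norm (x - y) \<le> D"
  shows "capacity_exponent \<theta> t E s r \<le> t - t * ln D * inverse (ln r)"
proof -
  have D0: "0 < D" using D r by linarith
  have "t * (ln r - ln D) = ln ((r / D) powr t)" using r D0 by (simp add: ln_powr ln_div)
  also have "\<dots> \<le> ln (min_energy r \<theta> s t E)"
    using min_energy_bounds[OF E s D] r D0 by (subst ln_le_cancel_iff) auto
  finally have "ln (min_energy r \<theta> s t E) / ln r \<le> t * (ln r - ln D) / ln r"
    using r by (intro divide_right_mono_neg) auto
  then show ?thesis using r unfolding capacity_exponent_min_energy by (simp add: field_simps)
qed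

lemma capacity_exponent_mono:
  assumes E: "E \<noteq> {}" and s: "0 \<le> s" "s \<le> s'" "s' \<le> t"
    and D: "r \<le> D" "\<And>x y. x \<in> E \<Longrightarrow> y \<in> E \<Longrightarrow> norm (x - y) \<le> D"
  shows "capacity_exponent \<theta> t E s r \<le> capacity_exponent \<theta> t E s' r"
proof -
  have pos: "0 < min_energy r \<theta> s' t E" "0 < min_energy r \<theta> s t E"
    using min_energy_bounds(3)[OF E _ _ D] s by auto
  then have "ln (min_energy r \<theta> s' t E) \<le> ln (min_energy r \<theta> s t E)"
    using min_energy_antimono_s[OF E s] by simp
  then show ?thesis unfolding capacity_exponent_min_energy
    using r by (intro divide_right_mono_neg) auto
qed

lemma capacity_exponent_lipschitz:
  assumes E: "E \<noteq> {}" and s: "0 \<le> s" "s \<le> s'" "s' \<le> t"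
    and D: "r \<le> D" "\<And>x y. x \<in> E \<Longrightarrow> y \<in> E \<Longrightarrow> norm (x - y) \<le> D"
  shows "capacity_exponent \<theta> t E s' r \<le> capacity_exponent \<theta> t E s r + (1 - \<theta>) * (s' - s)"
proof -
  have pos: "0 < min_energy r \<theta> s' t E" "0 < min_energy r \<theta> s t E"
    using min_energy_bounds(3)[OF E _ _ D] s by auto
  have "(1 - \<theta>) * (s' - s) * ln r + ln (min_energy r \<theta> s t E)
      = ln (r powr ((1 - \<theta>) * (s' - s)) * min_energy r \<theta> s t E)"
    using pos r by (simp add: ln_mult ln_powr)
  also have "\<dots> \<le> ln (min_energy r \<theta> s' t E)"
    using min_energy_lipschitz_s[OF E s] pos r by (subst ln_le_cancel_iff) auto
  finally have "ln (min_energy r \<theta> s' t E) / ln r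
      \<le> ((1 - \<theta>) * (s' - s) * ln r + ln (min_energy r \<theta> s t E)) / ln r"
    using r by (intro divide_right_mono_neg) auto
  also have "\<dots> = ln (min_energy r \<theta> s t E) / ln r + (1 - \<theta>) * (s' - s)"
    using r by (simp add: add_divide_distrib)
  finally show ?thesis by (simp add: capacity_exponent_min_energy)
qed

end

text \<open>
  The profiles are definite descriptions, so their values are meaningful only once existence and
  uniqueness are known.  The functional \<open>\<Phi>\<close> stands for the lower or the upper limit as \<open>r\<close> tends to 0.
  As a function of \<open>s\<close>, the limiting exponent maps the interval from 0 to \<open>t\<close> into itself and is
  Lipschitz with constant \<open>1 - \<theta> < 1\<close>; the Banach fixed point theorem yields exactly one fixed point.
\<close>
lemma unique_profile_exponent:
  fixes \<Phi> :: "(real \<Rightarrow> ereal) \<Rightarrow> ereal" and E :: "(real ^ 'n) set"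
  assumes mono: "\<And>u v. eventually (\<lambda>r. u r \<le> v r) (at_right 0) \<Longrightarrow> \<Phi> u \<le> \<Phi> v"
    and shift: "\<And>u c. \<Phi> (\<lambda>r. u r + ereal c) = \<Phi> u + ereal c"
    and lim: "\<And>u l. (u \<longlongrightarrow> l) (at_right 0) \<Longrightarrow> \<Phi> u = l"
    and \<theta>: "0 < \<theta>" "\<theta> \<le> 1" and t: "0 < t" and E: "E \<noteq> {}" "bounded E"
  shows "\<exists>!s. 0 \<le> s \<and> s \<le> t \<and> \<Phi> (\<lambda>r. ereal (capacity_exponent \<theta> t E s r)) = ereal s"
proof -
  obtain D where D: "1 \<le> D" "\<And>x y. x \<in> E \<Longrightarrow> y \<in> E \<Longrightarrow> norm (x - y) \<le> D"
  proof -
    have "norm (x - y) \<le> max 1 (diameter E)" if "x \<in> E" "y \<in> E" for x y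
      using diameter_bounded_bound[OF E(2) that] by (simp add: dist_norm)
    then show thesis using that[of "max 1 (diameter E)"] by auto
  qed
  define f where "f s = \<Phi> (\<lambda>r. ereal (capacity_exponent \<theta> t E s r))" for s
  have small: "eventually (\<lambda>r::real. profile_params r \<theta> t \<and> r \<le> D) (at_right 0)"
    using \<theta> t D(1) unfolding eventually_at_right_field profile_params_def
    by (intro exI[of _ 1]) auto
  have f0: "0 \<le> f s" if "0 \<le> s" "s \<le> t" for s
  proof -
    have "\<Phi> (\<lambda>_. 0) \<le> f s" unfolding f_def
      by (rule mono, use small in eventually_elim)
        (use profile_params.capacity_exponent_nonneg[OF _ E(1) that _ D(2)] in auto)
    then show ?thesis using lim[of "\<lambda>_. 0" 0] by simp
  qed
  have ft: "f s \<le> t" if "0 \<le> s" "s \<le> t" for s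
  proof -
    have "((\<lambda>r. inverse (ln r)) \<longlongrightarrow> 0) (at_right (0::real))"
      using filterlim_compose[OF tendsto_inverse_0 filterlim_mono[OF ln_at_0 at_bot_le_at_infinity order_refl]] .
    then have "((\<lambda>r. t - t * ln D * inverse (ln r)) \<longlongrightarrow> t - t * ln D * 0) (at_right (0::real))"
      by (intro tendsto_intros)
    then have "\<Phi> (\<lambda>r. ereal (t - t * ln D * inverse (ln r))) = ereal t"
      by (intro lim) simp
    moreover have "f s \<le> \<Phi> (\<lambda>r. ereal (t - t * ln D * inverse (ln r)))" unfolding f_def
      by (rule mono, use small in eventually_elim)
        (use profile_params.capacity_exponent_le[OF _ E(1) that _ D(2)] in auto)
    ultimately show ?thesis by simp
  qed
  have fin: "\<bar>f s\<bar> \<noteq> \<infinity>" if "0 \<le> s" "s \<le> t" for s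
    using f0[OF that] ft[OF that] by auto
  have step: "f s \<le> f s'" "f s' \<le> f s + ereal ((1 - \<theta>) * (s' - s))"
    if s: "0 \<le> s" "s \<le> s'" "s' \<le> t" for s s'
  proof -
    show "f s \<le> f s'" unfolding f_def
      by (rule mono, use small in eventually_elim)
        (use profile_params.capacity_exponent_mono[OF _ E(1) s _ D(2)] in auto)
    have "f s' \<le> \<Phi> (\<lambda>r. ereal (capacity_exponent \<theta> t E s r) + ereal ((1 - \<theta>) * (s' - s)))" unfolding f_def
      by (rule mono, use small in eventually_elim)
        (use profile_params.capacity_exponent_lipschitz[OF _ E(1) s _ D(2)] in auto)
    then show "f s' \<le> f s + ereal ((1 - \<theta>) * (s' - s))" by (simp only: shift f_def)
  qed
  have close: "\<bar>real_of_ereal (f s') - real_of_ereal (f s)\<bar> \<le> (1 - \<theta>) * \<bar>s' - s\<bar>"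
    if s: "0 \<le> s" "s \<le> s'" "s' \<le> t" for s s'
  proof -
    obtain a b where "f s = ereal a" "f s' = ereal b" using fin[of s] fin[of s'] s by fastforce
    then show ?thesis using step[OF s] s by simp
  qed
  have "\<exists>!s\<in>{0..t}. real_of_ereal (f s) = s"
  proof (rule Banach_fix[where c = "1 - \<theta>"])
    show "(\<lambda>s. real_of_ereal (f s)) ` {0..t} \<subseteq> {0..t}"
    proof
      fix z assume "z \<in> (\<lambda>s. real_of_ereal (f s)) ` {0..t}"
      then obtain s where s: "0 \<le> s" "s \<le> t" "z = real_of_ereal (f s)" by auto
      obtain a where "f s = ereal a" using fin[of s] s by fastforce
      then show "z \<in> {0..t}" using f0[of s] ft[of s] s by simp
    qed
    show "dist (real_of_ereal (f x)) (real_of_ereal (f y)) \<le> (1 - \<theta>) * dist x y"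
      if "x \<in> {0..t}" "y \<in> {0..t}" for x y
      using close[of x y] close[of y x] that
      by (cases "x \<le> y") (auto simp: dist_real_def abs_minus_commute)
  qed (use \<theta> t in \<open>simp_all add: compact_imp_complete\<close>)
  moreover have "real_of_ereal (f s) = s \<longleftrightarrow> f s = ereal s" if "0 \<le> s" "s \<le> t" for s
    using fin[OF that] by (cases "f s") auto
  ultimately show ?thesis unfolding f_def by auto
qed

lemma lower_dim_profile_exponent:
  fixes E :: "(real ^ 'n) set"
  assumes "0 < \<theta>" "\<theta> \<le> 1" "0 < t" "E \<noteq> {}" "bounded E"
  shows "0 \<le> lower_dim_profile \<theta> t E" "lower_dim_profile \<theta> t E \<le> t"
    "Liminf (at_right 0) (\<lambda>r. ereal (capacity_exponent \<theta> t E (lower_dim_profile \<theta> t E) r))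
      = ereal (lower_dim_profile \<theta> t E)"
proof -
  have "\<exists>!s. 0 \<le> s \<and> s \<le> t \<and> Liminf (at_right 0) (\<lambda>r. ereal (capacity_exponent \<theta> t E s r)) = ereal s"
    by (rule unique_profile_exponent)
      (use assms in \<open>auto intro: Liminf_mono simp: lim_imp_Liminf Liminf_add_ereal_right\<close>)
  from theI'[OF this] show "0 \<le> lower_dim_profile \<theta> t E" "lower_dim_profile \<theta> t E \<le> t"
    "Liminf (at_right 0) (\<lambda>r. ereal (capacity_exponent \<theta> t E (lower_dim_profile \<theta> t E) r))
      = ereal (lower_dim_profile \<theta> t E)"
    unfolding lower_dim_profile_def capacity_exponent_def by auto
qed

lemma upper_dim_profile_exponent:
  fixes E :: "(real ^ 'n) set"
  assumes "0 < \<theta>" "\<theta> \<le> 1" "0 < t" "E \<noteq> {}" "bounded E"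
  shows "0 \<le> upper_dim_profile \<theta> t E" "upper_dim_profile \<theta> t E \<le> t"
    "Limsup (at_right 0) (\<lambda>r. ereal (capacity_exponent \<theta> t E (upper_dim_profile \<theta> t E) r))
      = ereal (upper_dim_profile \<theta> t E)"
proof -
  have "\<exists>!s. 0 \<le> s \<and> s \<le> t \<and> Limsup (at_right 0) (\<lambda>r. ereal (capacity_exponent \<theta> t E s r)) = ereal s"
    by (rule unique_profile_exponent)
      (use assms in \<open>auto intro: Limsup_mono simp: lim_imp_Limsup Limsup_add_ereal_right\<close>)
  from theI'[OF this] show "0 \<le> upper_dim_profile \<theta> t E" "upper_dim_profile \<theta> t E \<le> t"
    "Limsup (at_right 0) (\<lambda>r. ereal (capacity_exponent \<theta> t E (upper_dim_profile \<theta> t E) r))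
      = ereal (upper_dim_profile \<theta> t E)"
    unfolding upper_dim_profile_def capacity_exponent_def by auto
qed

section \<open>Covers of balls at one scale\<close>

text \<open>
  The defect \<open>q\<close> measures by how much the growth of covering numbers may exceed the exponent \<open>t\<close>.  If
  \<open>d \<le> R powr (1 / \<alpha>)\<close>, the Assouad spectrum gives the excess factor \<open>(R / d) powr q\<close>, at most
  \<open>d powr (- q)\<close> since \<open>R < 1\<close>.  Otherwise \<open>R / d\<close> is less than \<open>d powr (\<alpha> - 1)\<close>, so the Assouad dimension
  may exceed \<open>t\<close> by \<open>q / (1 - \<alpha>)\<close> and still give an excess factor of at most \<open>d powr (- q)\<close>.  Radii
  of at least 1 are reduced to finitely many balls of radius \<open>1/2\<close>.
\<close>
lemma local_cover:
  fixes E :: "(real ^ 'n) set"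
  assumes \<alpha>: "0 < \<alpha>" "\<alpha> < 1" and q: "0 \<le> q" and t: "0 < t" and E: "bounded E"
    and spectrum: "upper_assouad_spectrum \<alpha> E < t + q"
    and assouad: "assouad_dim E < t + q / (1 - \<alpha>)"
  obtains C where "0 < C" "\<And>d R x. 0 < d \<Longrightarrow> d < 1/2 \<Longrightarrow> d < R \<Longrightarrow> x \<in> E \<Longrightarrow>
      \<exists>\<V>. finite \<V> \<and> ball x R \<inter> E \<subseteq> \<Union>\<V> \<and> (\<forall>U\<in>\<V>. bounded U \<and> diameter U = d) \<and>
        real (card \<V>) \<le> C * (R / d) powr t * d powr (- q)"
proof -
  let ?cover = "\<lambda>C d R F \<V>. finite \<V> \<and> F \<subseteq> \<Union>\<V> \<and> (\<forall>U\<in>\<V>. bounded U \<and> diameter U = d) \<and>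
        real (card \<V>) \<le> C * (R / d) powr t * d powr (- q)"
  obtain C1 where C1: "0 < C1" "\<And>r R x. 0 < r \<Longrightarrow> r \<le> R powr (1 / \<alpha>) \<Longrightarrow> 0 < R \<Longrightarrow> R < 1 \<Longrightarrow> x \<in> E \<Longrightarrow>
      real (covering_number r (ball x R \<inter> E)) \<le> C1 * (R / r) powr (t + q)"
    using spectrum_bound_above[OF spectrum \<alpha>] by blast
  obtain C2 where C2: "0 < C2" "\<And>r R x. 0 < r \<Longrightarrow> r < R \<Longrightarrow> x \<in> E \<Longrightarrow>
      real (covering_number r (ball x R \<inter> E)) \<le> C2 * (R / r) powr (t + q / (1 - \<alpha>))"
    using assouad_bound_above[OF assouad] by blast
  define C3 where "C3 = max C1 C2"
  have C3: "0 < C3" using C1(1) by (simp add: C3_def)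
  have below_one: "\<exists>\<V>. ?cover C3 d R (ball x R \<inter> E) \<V>"
    if d: "0 < d" "d < R" and R: "R < 1" and x: "x \<in> E" for d R x
  proof -
    have "real (covering_number d (ball x R \<inter> E)) \<le> C3 * (R / d) powr t * d powr (- q)"
    proof (cases "d \<le> R powr (1 / \<alpha>)")
      case True
      have "(R / d) powr q \<le> (1 / d) powr q" using d R q by (intro powr_mono2 divide_right_mono) auto
      also have "\<dots> = d powr (- q)" using d by (simp add: powr_minus_divide powr_divide)
      finally have le: "(R / d) powr q \<le> d powr (- q)" .
      have "real (covering_number d (ball x R \<inter> E)) \<le> C1 * (R / d) powr (t + q)"
        using C1(2)[OF d(1) True _ R x] d by simp
      also have "\<dots> = C1 * (R / d) powr t * (R / d) powr q" by (simp add: powr_add)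
      also have "\<dots> \<le> C3 * (R / d) powr t * d powr (- q)"
        using le C1(1) by (intro mult_mono) (auto simp: C3_def)
      finally show ?thesis .
    next
      case False
      have "R = (R powr (1 / \<alpha>)) powr \<alpha>" using d \<alpha> by (simp add: powr_powr)
      also have "\<dots> \<le> d powr \<alpha>" using False \<alpha> by (intro powr_mono2) auto
      finally have "R / d \<le> d powr (\<alpha> - 1)" using d by (simp add: powr_diff divide_right_mono)
      then have "(R / d) powr (q / (1 - \<alpha>)) \<le> (d powr (\<alpha> - 1)) powr (q / (1 - \<alpha>))"
        using d q \<alpha> by (intro powr_mono2) auto
      also have "\<dots> = d powr (- q)"
      proof -
        have "(\<alpha> - 1) * (q / (1 - \<alpha>)) = - q" using \<alpha> by (simp add: field_simps)
        then show ?thesis by (simp add: powr_powr)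
      qed
      finally have le: "(R / d) powr (q / (1 - \<alpha>)) \<le> d powr (- q)" .
      have "real (covering_number d (ball x R \<inter> E)) \<le> C2 * (R / d) powr (t + q / (1 - \<alpha>))"
        using C2(2)[OF d x] .
      also have "\<dots> = C2 * (R / d) powr t * (R / d) powr (q / (1 - \<alpha>))" by (simp add: powr_add)
      also have "\<dots> \<le> C3 * (R / d) powr t * d powr (- q)"
        using le C2(1) by (intro mult_mono) (auto simp: C3_def)
      finally show ?thesis .
    qed
    moreover obtain \<V> where "finite \<V>" "ball x R \<inter> E \<subseteq> \<Union>\<V>" "\<And>U. U \<in> \<V> \<Longrightarrow> bounded U \<and> diameter U = d"
      "card \<V> = covering_number d (ball x R \<inter> E)"
      using covering_number_attained[of "ball x R \<inter> E" d] d by (metis bounded_Int bounded_ball)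
    ultimately show ?thesis by metis
  qed
  obtain R0 where R0: "E \<subseteq> ball 0 R0" using bounded_subset_ballD[OF E] by blast
  have "E \<subseteq> ball 0 (max R0 1)" using R0 by auto
  then obtain Y where Y: "finite Y" "Y \<subseteq> E" "E \<subseteq> (\<Union>y\<in>Y. ball y (1/2))"
    by (rule finite_net[where r = "1/2"]) auto
  define C where "C = C3 * (1 + real (card Y))"
  have C: "0 < C" "C3 \<le> C" "real (card Y) * C3 \<le> C" using C3 by (auto simp: C_def algebra_simps intro!: add_pos_nonneg)
  have "\<exists>\<V>. ?cover C d R (ball x R \<inter> E) \<V>" if d: "0 < d" "d < 1/2" "d < R" and x: "x \<in> E" for d R x
  proof (cases "R < 1")
    case True
    obtain \<V> where \<V>: "?cover C3 d R (ball x R \<inter> E) \<V>" using below_one[OF d(1,3) True x] by blast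
    then have "real (card \<V>) \<le> C3 * ((R / d) powr t * d powr (- q))" by (simp add: mult.assoc)
    also have "\<dots> \<le> C * ((R / d) powr t * d powr (- q))" using C by (intro mult_right_mono) auto
    finally show ?thesis using \<V> by (auto simp: mult.assoc)
  next
    case False
    have "\<forall>y\<in>Y. \<exists>\<V>. ?cover C3 d (1/2) (ball y (1/2) \<inter> E) \<V>"
      by (intro ballI below_one) (use d Y in auto)
    then obtain V where V: "\<And>y. y \<in> Y \<Longrightarrow> ?cover C3 d (1/2) (ball y (1/2) \<inter> E) (V y)" by metis
    have "real (card (\<Union>(V ` Y))) \<le> (\<Sum>y\<in>Y. real (card (V y)))"
      using card_UN_le[OF Y(1), of V] by (simp only: of_nat_sum[symmetric] of_nat_le_iff)
    also have "\<dots> \<le> (\<Sum>y\<in>Y. C3 * (1/2 / d) powr t * d powr (- q))" by (intro sum_mono) (use V in auto)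
    also have "\<dots> = (real (card Y) * C3) * ((1/2 / d) powr t * d powr (- q))" by simp
    also have "\<dots> \<le> C * ((R / d) powr t * d powr (- q))"
      using False d C t by (intro mult_mono[OF C(3)] mult_right_mono powr_mono2 divide_right_mono) auto
    finally have "real (card (\<Union>(V ` Y))) \<le> C * (R / d) powr t * d powr (- q)" by (simp add: mult.assoc)
    moreover have "ball x R \<inter> E \<subseteq> \<Union>(\<Union>(V ` Y))"
    proof
      fix z assume "z \<in> ball x R \<inter> E"
      then obtain y where "y \<in> Y" "z \<in> ball y (1/2) \<inter> E" using Y(3) by blast
      then show "z \<in> \<Union>(\<Union>(V ` Y))" using V[of y] by blast
    qed
    ultimately show ?thesis using V Y(1) by (intro exI[of _ "\<Union>(V ` Y)"]) auto
  qed
  then show thesis using that C(1) by blast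
qed

section \<open>Covers from small capacity\<close>

context profile_params
begin

text \<open>
  A pigeonhole over the scales \<open>r powr (1 - \<kappa> * k)\<close> with \<open>k \<le> m\<close>: if the potential at \<open>x\<close> is large, some
  ball about \<open>x\<close> has large mass compared with the kernel at its radius.  The ratio of consecutive scales is a small
  negative power of \<open>r\<close> rather than 2, so that the number of scales stays bounded as \<open>r\<close> tends to 0.
\<close>
lemma potential_concentrates:
  fixes x :: "real ^ 'n"
  assumes s: "0 \<le> s" "s \<le> t" and Y: "finite Y" and p: "\<And>y. 0 \<le> p y"
    and \<kappa>: "0 < \<kappa>" "2 \<le> \<kappa> * real m" and near: "\<And>y. y \<in> Y \<Longrightarrow> dist x y < 1 / r"
  obtains \<rho> where "r \<le> \<rho>"
    "(\<Sum>y\<in>Y. p y * radial_kernel r \<theta> s t (dist x y))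
      \<le> r powr (- \<kappa> * t) * (real m + 1) * radial_kernel r \<theta> s t \<rho> * sum p {y\<in>Y. dist x y < \<rho>}"
proof -
  let ?k = "radial_kernel r \<theta> s t"
  let ?c = "r powr (- \<kappa>)"
  define R where "R k = r powr (1 - \<kappa> * real k)" for k :: nat
  define T where "T k = ?c powr t * ?k (R k) * sum p {y\<in>Y. dist x y < R k}" for k
  have c: "1 \<le> ?c" using r \<kappa> by (simp add: powr_minus one_le_inverse_iff powr_le1)
  have Rr: "r \<le> R k" for k
    using r \<kappa> powr_mono'[of "1 - \<kappa> * real k" 1 r] by (simp add: R_def)
  have R_Suc: "R (Suc k) = ?c * R k" for k by (simp add: R_def powr_add[symmetric] algebra_simps)
  have R0: "R 0 = r" using r by (simp add: R_def)
  \<comment> \<open>The condition \<open>2 \<le> \<kappa> * m\<close> lets the last scale reach \<open>1 / r\<close>, beyond all distances that occur.\<close>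
  have "1 / r = r powr (- 1)" using r by (simp add: powr_minus_divide)
  also have "\<dots> \<le> R m" unfolding R_def using r \<kappa> by (intro powr_mono') auto
  finally have Rm: "1 / r \<le> R m" .
  have T0: "0 \<le> T k" for k
    unfolding T_def by (intro mult_nonneg_nonneg radial_kernel_nonneg sum_nonneg p) auto
  have pt: "?k (dist x y) \<le> (\<Sum>k\<le>m. ?c powr t * ?k (R k) * (if dist x y < R k then 1 else 0))" if y: "y \<in> Y" for y
  proof -
    \<comment> \<open>The first scale exceeding the distance: the previous one, if any, is at most the distance.\<close>
    define k where "k = (LEAST k. dist x y < R k)"
    have ym: "dist x y < R m" using near[OF y] Rm by linarith
    have k: "dist x y < R k" "k \<le> m"
      unfolding k_def using ym by (auto intro: LeastI Least_le)
    have "?k (dist x y) \<le> ?c powr t * ?k (R k)"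
    proof (cases k)
      case 0
      have "1 * 1 \<le> ?c powr t * ?k (R k)"
      proof (rule mult_mono)
        show "1 \<le> ?c powr t" by (rule ge_one_powr_ge_zero[OF c less_imp_le[OF t]])
        have "?k r = 1" using r r_le_r_powr by (simp add: radial_kernel_def)
        then show "1 \<le> ?k (R k)" using 0 R0 by simp
      qed auto
      then show ?thesis using radial_kernel_le_1[OF s] by (metis mult_1 order_trans)
    next
      case (Suc j)
      have "\<not> dist x y < R j" using not_less_Least[of j "\<lambda>k. dist x y < R k"] Suc by (simp add: k_def)
      then have "?k (dist x y) \<le> ?k (R j)" by (intro radial_kernel_antimono s) auto
      also have "\<dots> \<le> ?c powr t * ?k (?c * R j)" by (intro radial_kernel_doubling s c Rr)
      finally show ?thesis using Suc R_Suc by simp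
    qed
    also have "\<dots> = ?c powr t * ?k (R k) * (if dist x y < R k then 1 else 0)" using k by simp
    also have "\<dots> \<le> (\<Sum>k\<le>m. ?c powr t * ?k (R k) * (if dist x y < R k then 1 else 0))"
      using k(2) by (intro member_le_sum) (auto intro!: mult_nonneg_nonneg radial_kernel_nonneg)
    finally show ?thesis .
  qed
  have "(\<Sum>y\<in>Y. p y * ?k (dist x y))
      \<le> (\<Sum>y\<in>Y. p y * (\<Sum>k\<le>m. ?c powr t * ?k (R k) * (if dist x y < R k then 1 else 0)))"
    by (intro sum_mono mult_left_mono pt p)
  also have "\<dots> = (\<Sum>k\<le>m. \<Sum>y\<in>Y. ?c powr t * ?k (R k) * (if dist x y < R k then p y else 0))"
    by (subst sum.swap) (auto simp: sum_distrib_left intro!: sum.cong)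
  also have "\<dots> = (\<Sum>k\<le>m. T k)"
    unfolding T_def using Y by (simp add: sum_distrib_left[symmetric] sum.inter_filter)
  finally have total: "(\<Sum>y\<in>Y. p y * ?k (dist x y)) \<le> (\<Sum>k\<le>m. T k)" .
  obtain k where k: "\<And>j. j \<le> m \<Longrightarrow> T j \<le> T k"
  proof -
    have "Max (T ` {..m}) \<in> T ` {..m}" by (rule Max_in) auto
    then obtain k where "T k = Max (T ` {..m})" by (metis imageE)
    then show thesis using that[of k] by simp
  qed
  have "(\<Sum>k\<le>m. T k) \<le> real (card {..m}) * T k" by (rule sum_bounded_above) (use k in auto)
  with total have "(\<Sum>y\<in>Y. p y * ?k (dist x y)) \<le> (real m + 1) * T k" by (simp add: add.commute)
  also have "\<dots> = r powr (- \<kappa> * t) * (real m + 1) * ?k (R k) * sum p {y\<in>Y. dist x y < R k}"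
    by (simp add: T_def powr_powr)
  finally show thesis using that Rr by blast
qed

end

lemma sum_UN_le:
  fixes f :: "'b \<Rightarrow> real"
  assumes "finite A" "\<And>x. x \<in> A \<Longrightarrow> finite (V x)" "\<And>u. 0 \<le> f u"
  shows "sum f (\<Union>(V ` A)) \<le> (\<Sum>x\<in>A. sum f (V x))"
  using assms
proof (induction A rule: finite_induct)
  case (insert a A)
  have "sum f (V a \<union> \<Union>(V ` A)) + sum f (V a \<inter> \<Union>(V ` A)) = sum f (V a) + sum f (\<Union>(V ` A))"
    by (rule sum.union_inter) (use insert in auto)
  moreover have "0 \<le> sum f (V a \<inter> \<Union>(V ` A))" by (intro sum_nonneg insert)
  ultimately show ?case using insert by auto
qed simp

context profile_params
begin

text \<open>
  The local cost estimate: a ball of radius \<open>\<rho>\<close> and mass \<open>w\<close> found by the pigeonhole is covered, after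
  enlargement, at a cost proportional to \<open>w\<close>.  If \<open>10 * \<rho> \<le> r powr \<theta>\<close> the enlarged ball is itself a
  permitted set, and the inner branch of the kernel bounds \<open>\<rho> powr s\<close> by the mass.  Otherwise it is split
  into sets of the largest permitted diameter \<open>r powr \<theta>\<close>; the outer branch bounds \<open>\<rho> powr t\<close> by the mass, and the number of
  pieces grows like \<open>\<rho> powr t\<close> up to the defect that \<open>M\<close> pays for.
\<close>
lemma cover_of_heavy_ball:
  fixes E :: "(real ^ 'n) set"
  assumes s: "0 \<le> s" "s \<le> t" and M: "0 \<le> M" and \<eta>: "0 < \<eta>" and \<rho>: "r \<le> \<rho>"
    and N: "0 \<le> N" and w: "0 \<le> w" and C: "0 < C"
    and heavy: "r powr (s + \<theta> * \<eta> / 4) \<le> N * radial_kernel r \<theta> s t \<rho> * w"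
    and cover: "r powr \<theta> < 10 * \<rho> \<Longrightarrow>
      \<exists>\<V>. finite \<V> \<and> ball x (10 * \<rho>) \<inter> E \<subseteq> \<Union>\<V> \<and> (\<forall>U\<in>\<V>. bounded U \<and> diameter U = r powr \<theta>) \<and>
        real (card \<V>) \<le> C * (10 * \<rho> / r powr \<theta>) powr t * (r powr \<theta>) powr (- (M + \<eta> / 2))"
  obtains \<V> where "finite \<V>" "ball x (5 * \<rho>) \<inter> E \<subseteq> \<Union>\<V>"
    "\<And>U. U \<in> \<V> \<Longrightarrow> bounded U \<and> r \<le> diameter U \<and> diameter U \<le> r powr \<theta>"
    "(\<Sum>U\<in>\<V>. diameter U powr (s + M + \<eta>)) \<le> (1 + C) * 10 powr t * N * r powr (\<theta> * \<eta> / 4) * w"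
proof -
  have \<rho>0: "0 < \<rho>" using \<rho> r by linarith
  define d where "d = r powr \<theta>"
  have d: "0 < d" "d \<le> 1" using r \<theta> by (auto simp: d_def powr_le1)
  have d_powr: "d powr a = r powr (\<theta> * a)" for a by (simp add: d_def powr_powr)
  show thesis
  proof (cases "10 * \<rho> \<le> d")
    case True
    have "r powr s * (r powr (\<theta> * \<eta> / 4) * \<rho> powr s) = r powr (s + \<theta> * \<eta> / 4) * \<rho> powr s"
      by (simp add: powr_add)
    also have "\<dots> \<le> N * radial_kernel r \<theta> s t \<rho> * w * \<rho> powr s" using heavy by (intro mult_right_mono) auto
    also have "\<dots> \<le> N * (r / \<rho>) powr s * w * \<rho> powr s"
      using N w by (intro mult_right_mono mult_left_mono radial_kernel_le_inner s \<rho>0) auto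
    also have "\<dots> = r powr s * (N * w)" using r \<rho>0 by (simp add: powr_divide)
    finally have mass: "r powr (\<theta> * \<eta> / 4) * \<rho> powr s \<le> N * w"
      using r by (simp add: mult_le_cancel_left_pos)
    have "(10 * \<rho>) powr (s + M + \<eta>) = 10 powr s * \<rho> powr s * (10 * \<rho>) powr (M + \<eta>)"
      using \<rho>0 by (simp add: powr_add powr_mult)
    also have "\<dots> \<le> 10 powr t * \<rho> powr s * (d powr \<eta>)"
    proof (intro mult_mono)
      have "(10 * \<rho>) powr (M + \<eta>) \<le> d powr (M + \<eta>)" using True \<rho>0 M \<eta> by (intro powr_mono2) auto
      also have "\<dots> \<le> d powr \<eta>" using d M by (intro powr_mono') auto
      finally show "(10 * \<rho>) powr (M + \<eta>) \<le> d powr \<eta>" .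
    qed (use s in auto)
    also have "d powr \<eta> = r powr (\<theta> * \<eta> / 4) * r powr (3 * (\<theta> * \<eta>) / 4)"
      unfolding d_powr powr_add[symmetric] by (simp add: algebra_simps)
    also have "10 powr t * \<rho> powr s * (r powr (\<theta> * \<eta> / 4) * r powr (3 * (\<theta> * \<eta>) / 4))
        = 10 powr t * r powr (3 * (\<theta> * \<eta>) / 4) * (r powr (\<theta> * \<eta> / 4) * \<rho> powr s)" by simp
    also have "\<dots> \<le> ((1 + C) * 10 powr t) * r powr (\<theta> * \<eta> / 4) * (N * w)"
    proof (rule mult_mono[OF _ mass])
      have "0 < \<theta> * \<eta>" using \<theta> \<eta> by simp
      then have "r powr (3 * (\<theta> * \<eta>) / 4) \<le> r powr (\<theta> * \<eta> / 4)" using r by (intro powr_mono') (auto simp: mult.commute)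
      then show "10 powr t * r powr (3 * (\<theta> * \<eta>) / 4) \<le> (1 + C) * 10 powr t * r powr (\<theta> * \<eta> / 4)"
        using C by (intro mult_mono) auto
    qed (use C in auto)
    finally have "(\<Sum>U\<in>{ball x (5 * \<rho>)}. diameter U powr (s + M + \<eta>))
        \<le> (1 + C) * 10 powr t * N * r powr (\<theta> * \<eta> / 4) * w"
      using \<rho>0 by (simp add: ac_simps)
    then show thesis using True \<rho> \<rho>0 by (intro that[of "{ball x (5 * \<rho>)}"]) (auto simp: d_def)
  next
    case False
    then obtain \<V> where \<V>: "finite \<V>" "ball x (10 * \<rho>) \<inter> E \<subseteq> \<Union>\<V>" "\<And>U. U \<in> \<V> \<Longrightarrow> bounded U \<and> diameter U = d"
      "real (card \<V>) \<le> C * (10 * \<rho> / d) powr t * d powr (- (M + \<eta> / 2))"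
      using cover unfolding d_def by auto
    have "r powr s * (r powr (\<theta> * \<eta> / 4) * \<rho> powr t) = r powr (s + \<theta> * \<eta> / 4) * \<rho> powr t"
      by (simp add: powr_add)
    also have "\<dots> \<le> N * radial_kernel r \<theta> s t \<rho> * w * \<rho> powr t" using heavy by (intro mult_right_mono) auto
    also have "\<dots> \<le> N * (r powr (\<theta> * (t - s) + s) / \<rho> powr t) * w * \<rho> powr t"
      using N w by (intro mult_right_mono mult_left_mono radial_kernel_le_outer s \<rho>0) auto
    also have "\<dots> = r powr s * (r powr (\<theta> * (t - s)) * (N * w))" using r \<rho>0 by (simp add: powr_add)
    finally have mass: "r powr (\<theta> * \<eta> / 4) * \<rho> powr t \<le> r powr (\<theta> * (t - s)) * (N * w)"
      using r by (simp add: mult_le_cancel_left_pos)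
    have "(\<Sum>U\<in>\<V>. diameter U powr (s + M + \<eta>)) = real (card \<V>) * d powr (s + M + \<eta>)"
      using \<V>(3) by simp
    also have "\<dots> \<le> C * (10 * \<rho> / d) powr t * d powr (- (M + \<eta> / 2)) * d powr (s + M + \<eta>)"
      using \<V>(4) by (intro mult_right_mono) auto
    also have "\<dots> = C * 10 powr t * \<rho> powr t * (d powr (- t) * d powr (- (M + \<eta> / 2)) * d powr (s + M + \<eta>))"
      using \<rho>0 d by (simp add: powr_divide powr_mult powr_minus field_simps)
    also have "d powr (- t) * d powr (- (M + \<eta> / 2)) * d powr (s + M + \<eta>) = d powr (s - t + \<eta> / 2)"
      unfolding powr_add[symmetric] by (simp add: algebra_simps)
    also have "\<dots> = r powr (\<theta> * \<eta> / 4) * (r powr (\<theta> * \<eta> / 4) * r powr (- (\<theta> * (t - s))))"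
      unfolding d_powr powr_add[symmetric] by (simp add: algebra_simps)
    also have "C * 10 powr t * \<rho> powr t * \<dots>
        = C * 10 powr t * r powr (\<theta> * \<eta> / 4) * r powr (- (\<theta> * (t - s))) * (r powr (\<theta> * \<eta> / 4) * \<rho> powr t)"
      by simp
    also have "\<dots> \<le> C * 10 powr t * r powr (\<theta> * \<eta> / 4) * r powr (- (\<theta> * (t - s))) * (r powr (\<theta> * (t - s)) * (N * w))"
      using mass C by (intro mult_left_mono) auto
    also have "\<dots> = C * (10 powr t * r powr (\<theta> * \<eta> / 4) * (N * w))"
      using r by (simp add: powr_minus)
    also have "\<dots> \<le> (1 + C) * (10 powr t * r powr (\<theta> * \<eta> / 4) * (N * w))"
      using N w by (intro mult_right_mono) auto
    finally have "(\<Sum>U\<in>\<V>. diameter U powr (s + M + \<eta>)) \<le> (1 + C) * 10 powr t * N * r powr (\<theta> * \<eta> / 4) * w"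
      by (simp add: ac_simps)
    moreover have "ball x (5 * \<rho>) \<inter> E \<subseteq> \<Union>\<V>"
    proof -
      have "ball x (5 * \<rho>) \<subseteq> ball x (10 * \<rho>)" using \<rho>0 by (intro subset_ball) auto
      then show ?thesis using \<V>(2) by blast
    qed
    ultimately show thesis using \<V>(1,3) r_le_r_powr by (intro that[of \<V>]) (auto simp: d_def)
  qed
qed

text \<open>
  Put equilibrium weights on a finite \<open>r\<close>-net of \<open>E\<close>.  Their energy is at least the minimal energy of
  \<open>E\<close>, so the potential is large at every net point and each net point has a heavy ball.  A Vitali subfamily
  is disjoint and still covers \<open>E\<close> after enlargement by 5; adding the local costs, the masses sum to at
  most 1.  The scale ratio is chosen through \<open>\<kappa> * t = \<theta> * \<eta> / 8\<close>: together with the error \<open>\<theta> * \<eta> / 8\<close>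
  in the energy it consumes \<open>\<theta> * \<eta> / 4\<close>, half of the gain \<open>\<theta> * \<eta> / 2\<close> in the exponent of \<open>r\<close> left by \<open>\<eta>\<close>
  after half of \<open>\<eta>\<close> has been spent on the local covering numbers.
\<close>
lemma cover_of_small_capacity:
  fixes E :: "(real ^ 'n) set"
  assumes s: "0 \<le> s" "s \<le> t" and M: "0 \<le> M" and \<eta>: "0 < \<eta>" and m: "16 * t \<le> \<theta> * \<eta> * real m"
    and D: "\<And>x y. x \<in> E \<Longrightarrow> y \<in> E \<Longrightarrow> dist x y < 1 / r" and E: "E \<noteq> {}" "bounded E"
    and cap: "r powr (s + \<theta> * \<eta> / 8) \<le> min_energy r \<theta> s t E"
    and C: "0 < C"
    and cover: "\<And>R x. r powr \<theta> < R \<Longrightarrow> x \<in> E \<Longrightarrow>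
      \<exists>\<V>. finite \<V> \<and> ball x R \<inter> E \<subseteq> \<Union>\<V> \<and> (\<forall>U\<in>\<V>. bounded U \<and> diameter U = r powr \<theta>) \<and>
        real (card \<V>) \<le> C * (R / r powr \<theta>) powr t * (r powr \<theta>) powr (- (M + \<eta> / 2))"
  obtains \<U> where "admissible_cover \<theta> (r powr \<theta>) E \<U>"
    "cover_sum (s + M + \<eta>) \<U> \<le> ennreal ((1 + C) * 10 powr t * (real m + 1) * r powr (\<theta> * \<eta> / 4))"
proof -
  define \<kappa> where "\<kappa> = \<theta> * \<eta> / (8 * t)"
  have \<kappa>: "0 < \<kappa>" "2 \<le> \<kappa> * real m" "\<kappa> * t = \<theta> * \<eta> / 8"
    using \<theta> \<eta> t m by (auto simp: \<kappa>_def field_simps)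
  obtain R0 where R0: "E \<subseteq> ball 0 R0" using bounded_subset_ballD[OF E(2)] by blast
  have "E \<subseteq> ball 0 (max R0 1)" using R0 by auto
  then obtain Y where Y: "finite Y" "Y \<subseteq> E" "E \<subseteq> (\<Union>y\<in>Y. ball y r)"
    by (rule finite_net[where r = r]) (use r in auto)
  have "Y \<noteq> {}" using Y(3) E(1) by auto
  define K where "K i j = radial_kernel r \<theta> s t (dist i j)" for i j :: "real ^ 'n"
  have sym: "K i j = K j i" for i j by (simp add: K_def dist_commute)
  obtain p where p: "\<And>i. 0 \<le> p i" "\<And>i. i \<notin> Y \<Longrightarrow> p i = 0" "sum p Y = 1"
    and eq: "\<And>i. i \<in> Y \<Longrightarrow> (\<Sum>i\<in>Y. \<Sum>j\<in>Y. p i * p j * K i j) \<le> (\<Sum>j\<in>Y. p j * K i j)"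
    by (rule equilibrium_weights[OF Y(1) \<open>Y \<noteq> {}\<close> sym]) (rule that)
  define w where "w x \<rho> = sum p {y\<in>Y. dist x y < \<rho>}" for x \<rho>
  have w0: "0 \<le> w x \<rho>" for x \<rho> unfolding w_def by (intro sum_nonneg p)
  have energy: "energy r \<theta> s t (discrete_measure p)
      = (\<Sum>i\<in>Y. \<Sum>j\<in>Y. p i * p j * K i j)"
  proof -
    have "energy r \<theta> s t (discrete_measure p)
        = (LINT y|discrete_measure p. (\<Sum>x\<in>Y. p x * profile_kernel r \<theta> s t (x - y)))"
      unfolding energy_def
      by (intro Bochner_Integration.integral_cong refl discrete_measure(2)[OF Y(1) p]) measurable
    also have "\<dots> = (\<Sum>y\<in>Y. p y * (\<Sum>x\<in>Y. p x * profile_kernel r \<theta> s t (x - y)))"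
      by (intro discrete_measure(2)[OF Y(1) p]) measurable
    finally show ?thesis
      by (simp add: K_def sum_distrib_left profile_kernel_radial dist_norm norm_minus_commute mult.assoc)
  qed
  have "\<exists>\<rho>. r \<le> \<rho> \<and> r powr (s + \<theta> * \<eta> / 4) \<le> (real m + 1) * radial_kernel r \<theta> s t \<rho> * w x \<rho>"
    if x: "x \<in> Y" for x
  proof -
    have near: "dist x y < 1 / r" if "y \<in> Y" for y using D x that Y(2) by blast
    obtain \<rho> where \<rho>: "r \<le> \<rho>" "(\<Sum>y\<in>Y. p y * radial_kernel r \<theta> s t (dist x y))
      \<le> r powr (- \<kappa> * t) * (real m + 1) * radial_kernel r \<theta> s t \<rho> * sum p {y\<in>Y. dist x y < \<rho>}"
      by (rule potential_concentrates[OF s Y(1) p(1) \<kappa>(1,2) near])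
    have "r powr (s + \<theta> * \<eta> / 8) \<le> energy r \<theta> s t (discrete_measure p)"
      using cap min_energy_le[OF discrete_measure(1)[OF Y(1) p Y(2)]] by (rule order_trans)
    also have "\<dots> \<le> r powr (- (\<theta> * \<eta> / 8)) * ((real m + 1) * radial_kernel r \<theta> s t \<rho> * w x \<rho>)"
      using eq[OF x] \<rho>(2) \<kappa>(3) by (simp add: energy K_def w_def mult.assoc)
    finally have "r powr (\<theta> * \<eta> / 8) * r powr (s + \<theta> * \<eta> / 8)
      \<le> r powr (\<theta> * \<eta> / 8) * (r powr (- (\<theta> * \<eta> / 8)) * ((real m + 1) * radial_kernel r \<theta> s t \<rho> * w x \<rho>))"
      by (intro mult_left_mono) auto
    also have "\<dots> = (real m + 1) * radial_kernel r \<theta> s t \<rho> * w x \<rho>" using r by (simp add: powr_minus)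
    also have "r powr (\<theta> * \<eta> / 8) * r powr (s + \<theta> * \<eta> / 8) = r powr (s + \<theta> * \<eta> / 4)"
      unfolding powr_add[symmetric] by (simp add: algebra_simps)
    finally show ?thesis using \<rho>(1) by blast
  qed
  then obtain \<rho> where \<rho>: "\<And>x. x \<in> Y \<Longrightarrow> r \<le> \<rho> x"
    and heavy: "\<And>x. x \<in> Y \<Longrightarrow> r powr (s + \<theta> * \<eta> / 4) \<le> (real m + 1) * radial_kernel r \<theta> s t (\<rho> x) * w x (\<rho> x)"
    by metis
  obtain A where A: "A \<subseteq> Y" "pairwise (\<lambda>i j. disjnt (ball i (\<rho> i)) (ball j (\<rho> j))) A"
     "E \<subseteq> (\<Union>i\<in>A. ball i (5 * \<rho> i))"
  proof (rule Vitali_covering_lemma_balls[where S = E and K = Y and a = "\<lambda>i. i" and r = \<rho> and B = "Max (\<rho> ` Y)"])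
    show "E \<subseteq> (\<Union>i\<in>Y. ball i (\<rho> i))"
    proof
      fix z assume "z \<in> E"
      then obtain y where "y \<in> Y" "dist y z < r" using Y(3) by auto
      then show "z \<in> (\<Union>i\<in>Y. ball i (\<rho> i))" using \<rho>[of y] by force
    qed
    show "0 < \<rho> i \<and> \<rho> i \<le> Max (\<rho> ` Y)" if "i \<in> Y" for i
      using \<rho>[OF that] r that Y(1) by auto
  qed auto
  have finA: "finite A" using A(1) Y(1) by (rule finite_subset)
  let ?K = "(1 + C) * 10 powr t * (real m + 1) * r powr (\<theta> * \<eta> / 4)"
  have "\<exists>\<V>. finite \<V> \<and> ball x (5 * \<rho> x) \<inter> E \<subseteq> \<Union>\<V> \<and>
      (\<forall>U\<in>\<V>. bounded U \<and> r \<le> diameter U \<and> diameter U \<le> r powr \<theta>) \<and>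
      (\<Sum>U\<in>\<V>. diameter U powr (s + M + \<eta>)) \<le> ?K * w x (\<rho> x)" if x: "x \<in> A" for x
  proof -
    have xY: "x \<in> Y" using x A by blast
    show ?thesis
      by (rule cover_of_heavy_ball[OF s M \<eta> \<rho>[OF xY] _ w0 C heavy[OF xY], of x E])
        (use cover xY Y(2) in auto)
  qed
  then obtain V where V: "\<And>x. x \<in> A \<Longrightarrow> finite (V x)" "\<And>x. x \<in> A \<Longrightarrow> ball x (5 * \<rho> x) \<inter> E \<subseteq> \<Union>(V x)"
      "\<And>x U. x \<in> A \<Longrightarrow> U \<in> V x \<Longrightarrow> bounded U \<and> r \<le> diameter U \<and> diameter U \<le> r powr \<theta>"
      "\<And>x. x \<in> A \<Longrightarrow> (\<Sum>U\<in>V x. diameter U powr (s + M + \<eta>)) \<le> ?K * w x (\<rho> x)"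
    by metis
  show thesis
  proof
    have "E \<subseteq> \<Union>(\<Union>(V ` A))"
    proof
      fix z assume z: "z \<in> E"
      then obtain x where "x \<in> A" "z \<in> ball x (5 * \<rho> x)" using A(3) by blast
      then show "z \<in> \<Union>(\<Union>(V ` A))" using z V(2)[of x] by blast
    qed
    moreover have "(r powr \<theta>) powr (1 / \<theta>) = r" using r \<theta> by (simp add: powr_powr)
    ultimately show "admissible_cover \<theta> (r powr \<theta>) E (\<Union>(V ` A))"
      unfolding admissible_cover_def using V(3) by auto
    have "(\<Sum>x\<in>A. w x (\<rho> x)) = sum p (\<Union>x\<in>A. {y\<in>Y. dist x y < \<rho> x})"
      unfolding w_def
    proof (rule sum.UNION_disjoint[symmetric])
      show "\<forall>i\<in>A. \<forall>j\<in>A. i \<noteq> j \<longrightarrow> {y\<in>Y. dist i y < \<rho> i} \<inter> {y\<in>Y. dist j y < \<rho> j} = {}"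
        using A(2) by (fastforce simp: pairwise_def disjnt_def)
    qed (use finA Y(1) in auto)
    also have "\<dots> \<le> sum p Y" by (rule sum_mono2) (use Y(1) p(1) in auto)
    finally have w1: "(\<Sum>x\<in>A. w x (\<rho> x)) \<le> 1" using p(3) by simp
    have K0: "0 \<le> ?K" using C by auto
    have fin: "finite (\<Union>(V ` A))" using finA V(1) by auto
    have "(\<Sum>U\<in>\<Union>(V ` A). diameter U powr (s + M + \<eta>)) \<le> (\<Sum>x\<in>A. \<Sum>U\<in>V x. diameter U powr (s + M + \<eta>))"
      by (rule sum_UN_le[OF finA V(1)]) auto
    also have "\<dots> \<le> (\<Sum>x\<in>A. ?K * w x (\<rho> x))" by (intro sum_mono V(4))
    also have "\<dots> \<le> ?K * 1" unfolding sum_distrib_left[symmetric] by (rule mult_left_mono[OF w1 K0])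
    finally have "(\<Sum>U\<in>\<Union>(V ` A). diameter U powr (s + M + \<eta>)) \<le> ?K" by simp
    moreover have "cover_sum (s + M + \<eta>) (\<Union>(V ` A)) = ennreal (\<Sum>U\<in>\<Union>(V ` A). diameter U powr (s + M + \<eta>))"
      unfolding cover_sum_def using fin by (simp add: infsum_finite sum_ennreal)
    ultimately show "cover_sum (s + M + \<eta>) (\<Union>(V ` A)) \<le> ennreal ?K" by (simp add: ennreal_leI)
  qed
qed

end

section \<open>Comparison of the dimensions\<close>

text \<open>
  The slack \<open>\<eta> / 2\<close> makes the defect \<open>M + \<eta> / 2\<close> strictly larger than what the Assouad-type
  dimensions require, and the cost of the resulting covers, a constant times
  \<open>r powr (\<theta> * \<eta> / 4)\<close>, tends to 0.
\<close>
lemma eventually_cover_of_small_capacity: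
  fixes E :: "(real ^ 'n) set"
  assumes \<theta>: "0 < \<theta>" "\<theta> \<le> 1" and \<alpha>: "0 < \<alpha>" "\<alpha> < 1" and t: "0 < t"
    and E: "E \<noteq> {}" "bounded E" and s: "0 \<le> s" "s \<le> t" and \<eta>: "0 < \<eta>" and M: "0 \<le> M"
    and spectrum: "upper_assouad_spectrum \<alpha> E - t \<le> M" and assouad: "(assouad_dim E - t) * (1 - \<alpha>) \<le> M"
    and \<epsilon>: "0 < \<epsilon>"
  shows "\<forall>\<^sub>F r in at_right 0. capacity_exponent \<theta> t E s r < s + \<theta> * \<eta> / 8 \<longrightarrow>
    (\<exists>\<U>. admissible_cover \<theta> (r powr \<theta>) E \<U> \<and> cover_sum (s + M + \<eta>) \<U> \<le> ennreal \<epsilon>)"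
proof -
  have "upper_assouad_spectrum \<alpha> E < t + (M + \<eta> / 2)" using spectrum \<eta> by linarith
  moreover have "assouad_dim E < t + (M + \<eta> / 2) / (1 - \<alpha>)"
  proof -
    have "(assouad_dim E - t) * (1 - \<alpha>) < M + \<eta> / 2" using assouad \<eta> by linarith
    then have "assouad_dim E - t < (M + \<eta> / 2) / (1 - \<alpha>)" using \<alpha> by (simp add: pos_less_divide_eq)
    then show ?thesis by linarith
  qed
  ultimately obtain C where C: "0 < C" "\<And>d R x. 0 < d \<Longrightarrow> d < 1/2 \<Longrightarrow> d < R \<Longrightarrow> x \<in> E \<Longrightarrow>
      \<exists>\<V>. finite \<V> \<and> ball x R \<inter> E \<subseteq> \<Union>\<V> \<and> (\<forall>U\<in>\<V>. bounded U \<and> diameter U = d) \<and>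
        real (card \<V>) \<le> C * (R / d) powr t * d powr (- (M + \<eta> / 2))"
    using local_cover[OF \<alpha> _ t E(2), of "M + \<eta> / 2"] M \<eta> by (metis add_nonneg_pos half_gt_zero less_imp_le)
  obtain m :: nat where "16 * t / (\<theta> * \<eta>) \<le> real m" using real_arch_simple by blast
  then have m: "16 * t \<le> \<theta> * \<eta> * real m" using \<theta> \<eta> by (simp add: field_simps)
  define D where "D = diameter E + 1"
  have D: "dist x y < D" if "x \<in> E" "y \<in> E" for x y
    using diameter_bounded_bound[OF E(2) that] by (simp add: D_def)
  have D1: "1 \<le> D" using diameter_ge_0[OF E(2)] by (simp add: D_def)
  let ?K = "\<lambda>r. (1 + C) * 10 powr t * (real m + 1) * r powr (\<theta> * \<eta> / 4)"
  have powr_lim: "((\<lambda>r. r powr a) \<longlongrightarrow> 0) (at_right 0)" if "0 < a" for a :: real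
    using that by real_asymp
  have "(?K \<longlongrightarrow> (1 + C) * 10 powr t * (real m + 1) * 0) (at_right 0)"
    using \<theta> \<eta> by (intro tendsto_intros powr_lim) auto
  then have "\<forall>\<^sub>F r in at_right 0. ?K r < \<epsilon>" by (rule order_tendstoD(2)) (use \<epsilon> in simp)
  moreover have "\<forall>\<^sub>F r in at_right 0. r powr \<theta> < 1/2"
    by (rule order_tendstoD(2)[OF powr_lim[OF \<theta>(1)]]) simp
  moreover have "\<forall>\<^sub>F r::real in at_right 0. 0 < r \<and> r < 1 \<and> r < 1 / D"
  proof -
    have "1 / D \<le> 1" "0 < 1 / D" using D1 by auto
    then show ?thesis unfolding eventually_at_right_field by (meson less_le_trans)
  qed
  ultimately show ?thesis
  proof eventually_elim
    case (elim r)
    interpret profile_params r \<theta> t using elim \<theta> t by unfold_locales auto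
    have rD: "D < 1 / r" using elim D1 by (simp add: field_simps)
    show ?case
    proof
      assume exponent: "capacity_exponent \<theta> t E s r < s + \<theta> * \<eta> / 8"
      have "0 < min_energy r \<theta> s t E"
        by (rule min_energy_bounds(3)[OF E(1) s, of D]) (use D D1 r in \<open>auto simp: dist_norm less_imp_le\<close>)
      moreover have "(s + \<theta> * \<eta> / 8) * ln r < ln (min_energy r \<theta> s t E)"
        using exponent r unfolding capacity_exponent_min_energy by (simp add: neg_divide_less_eq)
      ultimately have cap: "r powr (s + \<theta> * \<eta> / 8) \<le> min_energy r \<theta> s t E"
        using r by (simp add: powr_def ln_ge_iff[symmetric] less_imp_le exp_le_cancel_iff)
      obtain \<U> where "admissible_cover \<theta> (r powr \<theta>) E \<U>" "cover_sum (s + M + \<eta>) \<U> \<le> ennreal (?K r)"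
        by (rule cover_of_small_capacity[OF s M \<eta> m _ E cap C(1)])
          (use D rD C(2) elim in \<open>auto intro: order.strict_trans\<close>)
      moreover have "ennreal (?K r) \<le> ennreal \<epsilon>" using elim by (intro ennreal_leI) auto
      ultimately show "\<exists>\<U>. admissible_cover \<theta> (r powr \<theta>) E \<U> \<and> cover_sum (s + M + \<eta>) \<U> \<le> ennreal \<epsilon>"
        by (meson order_trans)
    qed
  qed
qed

lemma lower_intermediate_dim_le:
  fixes E :: "(real ^ 'n) set"
  assumes \<theta>: "0 < \<theta>" and \<sigma>: "0 \<le> \<sigma>"
    and cover: "\<And>\<epsilon>. 0 < \<epsilon> \<Longrightarrow> \<exists>\<^sub>F r in at_right 0. \<exists>\<U>. admissible_cover \<theta> (r powr \<theta>) E \<U> \<and> cover_sum \<sigma> \<U> \<le> ennreal \<epsilon>"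
  shows "lower_intermediate_dim \<theta> E \<le> \<sigma>"
  unfolding lower_intermediate_dim_def
proof (rule cInf_lower)
  show "\<sigma> \<in> {s. 0 \<le> s \<and> (\<forall>\<epsilon>>0. \<forall>\<delta>\<^sub>0>0. \<exists>\<delta>. 0 < \<delta> \<and> \<delta> \<le> \<delta>\<^sub>0 \<and>
          (\<exists>\<U>. admissible_cover \<theta> \<delta> E \<U> \<and> cover_sum s \<U> \<le> ennreal \<epsilon>))}"
  proof (intro CollectI conjI \<sigma> allI impI)
    fix \<epsilon> \<delta>\<^sub>0 :: real assume pos: "0 < \<epsilon>" "0 < \<delta>\<^sub>0"
    have "((\<lambda>r. r powr \<theta>) \<longlongrightarrow> 0) (at_right (0::real))" using \<theta> by real_asymp
    then have "\<forall>\<^sub>F r in at_right 0. r powr \<theta> < \<delta>\<^sub>0" using pos(2) by (rule order_tendstoD(2))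
    with eventually_at_right_less[of 0]
    have "\<forall>\<^sub>F r in at_right 0. 0 < r \<and> r powr \<theta> < \<delta>\<^sub>0" by (rule eventually_conj)
    from frequently_ex[OF frequently_eventually_frequently[OF cover[OF pos(1)] this]]
    obtain r where "\<exists>\<U>. admissible_cover \<theta> (r powr \<theta>) E \<U> \<and> cover_sum \<sigma> \<U> \<le> ennreal \<epsilon>" "0 < r" "r powr \<theta> < \<delta>\<^sub>0"
      by blast
    then show "\<exists>\<delta>. 0 < \<delta> \<and> \<delta> \<le> \<delta>\<^sub>0 \<and> (\<exists>\<U>. admissible_cover \<theta> \<delta> E \<U> \<and> cover_sum \<sigma> \<U> \<le> ennreal \<epsilon>)"
      by (intro exI[of _ "r powr \<theta>"]) auto
  qed
qed (auto intro!: bdd_belowI[of _ 0])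

text \<open>
  Every \<open>\<delta> > 0\<close> has the form \<open>r powr \<theta>\<close>, so statements about all small \<open>r\<close> cover all small \<open>\<delta>\<close>.
\<close>
lemma upper_intermediate_dim_le:
  fixes E :: "(real ^ 'n) set"
  assumes \<theta>: "0 < \<theta>" and \<sigma>: "0 \<le> \<sigma>"
    and cover: "\<And>\<epsilon>. 0 < \<epsilon> \<Longrightarrow> \<forall>\<^sub>F r in at_right 0. \<exists>\<U>. admissible_cover \<theta> (r powr \<theta>) E \<U> \<and> cover_sum \<sigma> \<U> \<le> ennreal \<epsilon>"
  shows "upper_intermediate_dim \<theta> E \<le> \<sigma>"
  unfolding upper_intermediate_dim_def
proof (rule cInf_lower)
  show "\<sigma> \<in> {s. 0 \<le> s \<and> (\<forall>\<epsilon>>0. \<exists>\<delta>\<^sub>0>0. \<forall>\<delta>. 0 < \<delta> \<and> \<delta> \<le> \<delta>\<^sub>0 \<longrightarrow>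
          (\<exists>\<U>. admissible_cover \<theta> \<delta> E \<U> \<and> cover_sum s \<U> \<le> ennreal \<epsilon>))}"
  proof (intro CollectI conjI \<sigma> allI impI)
    fix \<epsilon> :: real assume "0 < \<epsilon>"
    from cover[OF this] obtain b where b: "0 < b" "\<And>r. 0 < r \<Longrightarrow> r < b \<Longrightarrow>
        \<exists>\<U>. admissible_cover \<theta> (r powr \<theta>) E \<U> \<and> cover_sum \<sigma> \<U> \<le> ennreal \<epsilon>"
      unfolding eventually_at_right_field by auto
    show "\<exists>\<delta>\<^sub>0>0. \<forall>\<delta>. 0 < \<delta> \<and> \<delta> \<le> \<delta>\<^sub>0 \<longrightarrow>
        (\<exists>\<U>. admissible_cover \<theta> \<delta> E \<U> \<and> cover_sum \<sigma> \<U> \<le> ennreal \<epsilon>)"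
    proof (intro exI[of _ "(b/2) powr \<theta>"] conjI allI impI)
      fix \<delta> assume \<delta>: "0 < \<delta> \<and> \<delta> \<le> (b/2) powr \<theta>"
      have "\<delta> powr (1/\<theta>) \<le> ((b/2) powr \<theta>) powr (1/\<theta>)" using \<delta> \<theta> by (intro powr_mono2) auto
      also have "\<dots> < b" using b(1) \<theta> by (simp add: powr_powr)
      finally have "\<exists>\<U>. admissible_cover \<theta> ((\<delta> powr (1/\<theta>)) powr \<theta>) E \<U> \<and> cover_sum \<sigma> \<U> \<le> ennreal \<epsilon>"
        using \<delta> by (intro b(2)) auto
      then show "\<exists>\<U>. admissible_cover \<theta> \<delta> E \<U> \<and> cover_sum \<sigma> \<U> \<le> ennreal \<epsilon>"
        using \<delta> \<theta> by (simp add: powr_powr)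
    qed (use b in auto)
  qed
qed (auto intro!: bdd_belowI[of _ 0])

theorem theorem3p6:
  fixes \<theta> \<alpha> t :: real and E :: "(real ^ 'n) set"
  assumes "0 < \<theta>" and "\<theta> \<le> 1" and "0 < \<alpha>" and "\<alpha> < 1" and "0 < t"
    and "E \<noteq> {}" and "bounded E"
  shows "(lower_dim_profile \<theta> t E < t \<longrightarrow>
            lower_dim_profile \<theta> t E \<ge> lower_intermediate_dim \<theta> E
              - Max {0, upper_assouad_spectrum \<alpha> E - t, (assouad_dim E - t) * (1 - \<alpha>)})
       \<and> (upper_dim_profile \<theta> t E < t \<longrightarrow>
            upper_dim_profile \<theta> t E \<ge> upper_intermediate_dim \<theta> E
              - Max {0, upper_assouad_spectrum \<alpha> E - t, (assouad_dim E - t) * (1 - \<alpha>)})"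
proof -
  define M where "M = Max {0, upper_assouad_spectrum \<alpha> E - t, (assouad_dim E - t) * (1 - \<alpha>)}"
  have M: "0 \<le> M" "upper_assouad_spectrum \<alpha> E - t \<le> M" "(assouad_dim E - t) * (1 - \<alpha>) \<le> M"
    by (auto simp: M_def)
  note covers = eventually_cover_of_small_capacity[OF assms(1-7) _ _ _ M]
  have "lower_intermediate_dim \<theta> E \<le> lower_dim_profile \<theta> t E + M"
  proof (rule field_le_epsilon)
    fix \<eta> :: real assume \<eta>: "0 < \<eta>"
    define s where "s = lower_dim_profile \<theta> t E"
    note s = lower_dim_profile_exponent[OF assms(1,2,5-7), folded s_def]
    have "s < s + \<theta> * \<eta> / 8" using \<eta> assms(1) by simp
    then have "\<exists>\<^sub>F r in at_right 0. capacity_exponent \<theta> t E s r < s + \<theta> * \<eta> / 8"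
      using s(3) Liminf_bounded[of "ereal (s + \<theta> * \<eta> / 8)" "\<lambda>r. ereal (capacity_exponent \<theta> t E s r)" "at_right 0"]
      by (auto simp: frequently_def not_less)
    then have "lower_intermediate_dim \<theta> E \<le> s + M + \<eta>"
      using s(1) M(1) \<eta> assms(1)
      by (intro lower_intermediate_dim_le frequently_mp[OF covers[OF s(1,2) \<eta>]]) auto
    then show "lower_intermediate_dim \<theta> E \<le> lower_dim_profile \<theta> t E + M + \<eta>" by (simp add: s_def)
  qed
  moreover have "upper_intermediate_dim \<theta> E \<le> upper_dim_profile \<theta> t E + M"
  proof (rule field_le_epsilon)
    fix \<eta> :: real assume \<eta>: "0 < \<eta>"
    define s where "s = upper_dim_profile \<theta> t E"
    note s = upper_dim_profile_exponent[OF assms(1,2,5-7), folded s_def]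
    have "s < s + \<theta> * \<eta> / 8" using \<eta> assms(1) by simp
    then have "\<forall>\<^sub>F r in at_right 0. capacity_exponent \<theta> t E s r < s + \<theta> * \<eta> / 8"
      using s(3) Limsup_lessD[of "at_right 0" "\<lambda>r. ereal (capacity_exponent \<theta> t E s r)" "ereal (s + \<theta> * \<eta> / 8)"]
      by simp
    then have "upper_intermediate_dim \<theta> E \<le> s + M + \<eta>"
      using s(1) M(1) \<eta> assms(1)
      by (intro upper_intermediate_dim_le eventually_mp[OF covers[OF s(1,2) \<eta>]]) auto
    then show "upper_intermediate_dim \<theta> E \<le> upper_dim_profile \<theta> t E + M + \<eta>" by (simp add: s_def)
  qed
  ultimately show ?thesis by (simp add: M_def)
qed

end
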